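(* Let $d\ge 1$ be an integer, $\alpha\in(0,2)$, and $q>1$ a real number, and let $\mu$ be a probability measure on $\mathbb{Z}^d$ that is symmetric ($\mu(x)=\mu(-x)$ for all $x$) and for which there exist constants $c_1,c_2>0$ such that $$\frac{c_1}{|x|^{d+\alpha}}\le \mu(x)\le \frac{c_2}{|x|^{d+\alpha}}\qquad\text{for all }x\in\mathbb{Z}^d\setminus\{0\}.$$ If $q(d-\alpha)\ge d$, then $\kappa(q)$ is non-degenerate, i.e. $0<\kappa(q)<+\infty$, and $$\kappa(q)=\frac{1}{\rho(q)}.$$
   Context: $(X_t)_{t\ge0}$ is the continuous-time random walk on $\mathbb{Z}^d$ with jump rate $1$ and increment law $\mu$, i.e. with generator $Af(x)=\sum_{y\in\mathbb{Z}^d}\mu(y-x)(f(y)-f(x))$. Its transition probabilities are $p_t(x,y)=P_x(X_t=y)$, where $P_x$ is the law of the walk started at $x$. Its Green function is $G(x,y)=G(x-y)=\int_0^\infty p_t(x,y)\,dt$, which is finite because $q(d-\alpha)\ge d$ forces $\alpha<d$, so the walk is transient. $\langle\cdot,\cdot\rangle$ is the usual scalar product of real functions on $\mathbb{Z}^d$, $\|\cdot\|_p$ is the $\ell^p(\mathbb{Z}^d)$ norm, $(2q)'=\frac{2q}{2q-1}$ is the conjugate exponent of $2q$, and $Gg(x)=\sum_{y\in\mathbb{Z}^d}G(x-y)g(y)$. Define $$\rho(q)=\sup\{\langle g,Gg\rangle:\ g:\mathbb{Z}^d\to\mathbb{R},\ \mathrm{supp}(g)\text{ compact (i.e. finite)},\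 \|g\|_{(2q)'}=1\},$$ $$\kappa(q)=\inf\Big\{\frac{\langle f,-Af\rangle}{\|f\|_{2q}^2}:\ f:\mathbb{Z}^d\to\mathbb{R},\ \|f\|_2=1\Big\}.$$ *)

theory Defs
  imports "HOL-Probability.Probability"
begin

definition euclid_norm :: "int ^ 'd \<Rightarrow> real" where
  "euclid_norm x = norm (\<chi> i. real_of_int (x $ i))"

(* Canonical space carrying the pairs (holding time, increment), one for each jump:
   all independent, with Exp(1) holding times and increments of law mu. *)
definition walk_space :: "(int ^ 'd) pmf \<Rightarrow> (nat \<Rightarrow> real \<times> (int ^ 'd)) measure" where
  "walk_space \<mu> =
     (\<Pi>\<^sub>M n\<in>(UNIV :: nat set).
        density lborel (\<lambda>s. ennreal (exponential_density 1 s)) \<Otimes>\<^sub>M measure_pmf \<mu>)"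

(* Number of jumps in [0,t]; the n-th jump (counting from 0) happens at time
   fst (w 0) + ... + fst (w n).  Almost surely the set below is finite. *)
definition jump_count :: "(nat \<Rightarrow> real \<times> (int ^ 'd)) \<Rightarrow> real \<Rightarrow> nat" where
  "jump_count \<omega> t = card {n. (\<Sum>k\<le>n. fst (\<omega> k)) \<le> t}"

definition walk :: "int ^ 'd \<Rightarrow> real \<Rightarrow> (nat \<Rightarrow> real \<times> (int ^ 'd)) \<Rightarrow> int ^ 'd" where
  "walk x t \<omega> = x + (\<Sum>k<jump_count \<omega> t. snd (\<omega> k))"

definition transition :: "(int ^ 'd) pmf \<Rightarrow> real \<Rightarrow> int ^ 'd \<Rightarrow> int ^ 'd \<Rightarrow> real" where
  "transition \<mu> t x y = \<P>(\<omega> in walk_space \<mu>. walk x t \<omega> = y)"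

(* Real-valued: meaningful in the transient case only (a divergent integral would give 0). *)
definition green :: "(int ^ 'd) pmf \<Rightarrow> int ^ 'd \<Rightarrow> int ^ 'd \<Rightarrow> real" where
  "green \<mu> x y = (LINT t:{0..}|lborel. transition \<mu> t x y)"

definition green_op :: "(int ^ 'd) pmf \<Rightarrow> (int ^ 'd \<Rightarrow> real) \<Rightarrow> int ^ 'd \<Rightarrow> real" where
  "green_op \<mu> g x = (\<Sum>\<^sub>\<infinity>y. green \<mu> (x - y) 0 * g y)"

definition generator :: "(int ^ 'd) pmf \<Rightarrow> (int ^ 'd \<Rightarrow> real) \<Rightarrow> int ^ 'd \<Rightarrow> real" where
  "generator \<mu> f x = (\<Sum>\<^sub>\<infinity>y. pmf \<mu> (y - x) * (f y - f x))"

definition scalar_prod :: "(int ^ 'd \<Rightarrow> real) \<Rightarrow> (int ^ 'd \<Rightarrow> real) \<Rightarrow> real" where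
  "scalar_prod f g = (\<Sum>\<^sub>\<infinity>x. f x * g x)"

(* A divergent sum gives 0, so lp_norm p f = 1 entails that f lies in l^p. *)
definition lp_norm :: "real \<Rightarrow> (int ^ 'd \<Rightarrow> real) \<Rightarrow> real" where
  "lp_norm p f = (\<Sum>\<^sub>\<infinity>x. \<bar>f x\<bar> powr p) powr (1 / p)"

(* rho and kappa are extended reals, so that finiteness is a genuine assertion. *)
definition rho :: "(int ^ 'd) pmf \<Rightarrow> real \<Rightarrow> ereal" where
  "rho \<mu> q =
     (SUP g \<in> {g. finite {x. g x \<noteq> 0} \<and> lp_norm (2 * q / (2 * q - 1)) g = 1}.
        ereal (scalar_prod g (green_op \<mu> g)))"

definition kappa :: "(int ^ 'd) pmf \<Rightarrow> real \<Rightarrow> ereal" where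
  "kappa \<mu> q =
     (INF f \<in> {f. lp_norm 2 f = 1}.
        ereal (scalar_prod f (\<lambda>x. - generator \<mu> f x) / (lp_norm (2 * q) f)\<^sup>2))"

end

theory Submission
  imports Defs
begin

text \<open>
  Write \<open>P\<close> for the jump operator, so that \<open>-A = I - P\<close>, and \<open>\<E>(f, u) = \<langle>f, (I - P) u\<rangle>\<close> for the energy
  form on \<open>\<ell>\<^sup>2\<close>. Two facts make up the theorem. The first is the duality
  \<open>\<kappa>(q) = 1 / \<rho>(q)\<close> between a Sobolev inequality for \<open>\<E>\<close> and a bound for the Green form; the second is
  the Sobolev inequality itself, which shows that neither side degenerates.

  \<^bold>\<open>The Sobolev inequality.\<close> With \<open>p = 2d/(d - \<alpha>)\<close>, compare \<open>f x\<close> with its average over a box of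
  radius \<open>n\<close> around \<open>x\<close>. The oscillation in the box is at most a constant times
  \<open>n\<^bsup>\<alpha>/2\<^esup>\<close> times the root of the local energy at \<open>x\<close>, because \<open>\<mu>\<close> gives mass of order at least
  \<open>n\<^bsup>-d-\<alpha>\<^esup>\<close> to each jump in the box, and the average is at most \<open>n\<^bsup>-d/p\<^esup>\<close> times the
  \<open>p\<close>-norm (\<open>local_average_bound\<close>). Optimising over \<open>n\<close> bounds \<open>\<bar>f x\<bar>\<^sup>p\<close> by the local energy
  times a power of the norm (\<open>optimise_radius\<close>), and summing over \<open>x\<close> gives
  \<open>sobolev_inequality\<close>. The hypothesis \<open>q(d - \<alpha>) \<ge> d\<close> says that \<open>p \<le> 2q\<close>, and on a
  discrete space the \<open>2q\<close>-norm is then below the \<open>p\<close>-norm.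

  \<^bold>\<open>The Green function.\<close> The time spent at a site is the sum, over the holding periods, of the holding
  times of those periods that the walk spends there. Holding times have mean one and are independent of
  the positions, so the Green function is the sum of the convolution powers of \<open>\<mu>\<close>
  (\<open>green_eq_suminf\<close>).

  \<^bold>\<open>Duality.\<close> The partial sums \<open>u\<^sub>N = g + P g + \<dots> + P\<^bsup>N-1\<^esup> g\<close> of the Green potential of
  a finitely supported \<open>g\<close> stay in \<open>\<ell>\<^sup>2\<close> and satisfy \<open>(I - P) u\<^sub>N = g - P\<^sup>N g\<close>; they replace the
  inverse of the generator. For \<open>g \<ge> 0\<close> the energy of \<open>u\<^sub>N\<close> is at most
  \<open>\<langle>u\<^sub>N, g\<rangle>\<close>, and a Sobolev inequality for \<open>u\<^sub>N\<close> together with Hoelder's inequality bounds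
  \<open>\<langle>u\<^sub>N, g\<rangle>\<close> by the Sobolev constant (\<open>truncated_green_form_le\<close>). This proves
  transience, and with the best constant it proves \<open>\<rho> \<le> 1/\<kappa>\<close>. Conversely the Cauchy-Schwarz
  inequality for \<open>\<E>(f, u\<^sub>N)\<close> becomes \<open>\<langle>f, g\<rangle>\<^sup>2 \<le> \<E>(f, f) \<langle>g, G g\<rangle>\<close> in the limit
  (\<open>pairing_le_energy_green\<close>), and choosing for \<open>g\<close> the extremal function of Hoelder's
  inequality gives \<open>\<kappa> \<ge> 1/\<rho>\<close> (\<open>lp_norm_le_green_bound\<close>).
\<close>

section \<open>Summation in sequence spaces\<close>

lemma summable_on_real_bound:
  fixes f g :: "'a \<Rightarrow> real"
  assumes "g summable_on A" "\<And>x. x \<in> A \<Longrightarrow> \<bar>f x\<bar> \<le> g x"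
  shows "f summable_on A"
proof -
  have "(\<lambda>x. norm (f x)) summable_on A"
  proof (rule Infinite_Sum.abs_summable_on_comparison_test)
    show "(\<lambda>x. norm (g x)) summable_on A"
      using assms(1) summable_on_iff_abs_summable_on_real by blast
    show "norm (f x) \<le> norm (g x)" if "x \<in> A" for x
      using assms(2)[OF that] by simp
  qed
  then show ?thesis
    using summable_on_iff_abs_summable_on_real by blast
qed

lemma summable_on_Times_nonneg:
  fixes f :: "'a \<times> 'b \<Rightarrow> real"
  assumes "\<And>x y. 0 \<le> f (x, y)" "\<And>x. (\<lambda>y. f (x, y)) summable_on UNIV"
    and "(\<lambda>x. \<Sum>\<^sub>\<infinity>y. f (x, y)) summable_on UNIV"
  shows "f summable_on UNIV"
proof -
  have "(\<lambda>z. norm (f z)) summable_on (UNIV \<times> UNIV)"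
    unfolding Infinite_Sum.abs_summable_on_Sigma_iff
    using assms by (auto simp: infsum_nonneg)
  then show ?thesis
    using abs_summable_summable[of f] by simp
qed

lemma powr_le_powrD:
  fixes x y p :: real
  assumes "x powr p \<le> y powr p" "0 < p" "0 \<le> y"
  shows "x \<le> y"
  using powr_less_mono2[of p y x] assms by linarith

text \<open>A divergent sum has the value \<open>0\<close>, so that norm \<open>1\<close> is only possible for a convergent one.\<close>
lemma lp_norm_has_unit:
  assumes "lp_norm p f = 1" "0 < p"
  shows "(\<lambda>x. \<bar>f x\<bar> powr p) summable_on UNIV" "(\<Sum>\<^sub>\<infinity>x. \<bar>f x\<bar> powr p) = 1"
proof -
  have nz: "(\<Sum>\<^sub>\<infinity>x. \<bar>f x\<bar> powr p) \<noteq> 0"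
    using assms by (auto simp: lp_norm_def)
  then show "(\<lambda>x. \<bar>f x\<bar> powr p) summable_on UNIV"
    using infsum_not_exists by blast
  have "0 \<le> (\<Sum>\<^sub>\<infinity>x. \<bar>f x\<bar> powr p)"
    by (intro infsum_nonneg) auto
  then have "((\<Sum>\<^sub>\<infinity>x. \<bar>f x\<bar> powr p) powr (1 / p)) powr p = (\<Sum>\<^sub>\<infinity>x. \<bar>f x\<bar> powr p)"
    using assms by (simp add: powr_powr)
  with assms show "(\<Sum>\<^sub>\<infinity>x. \<bar>f x\<bar> powr p) = 1"
    by (simp add: lp_norm_def)
qed

lemma lp_norm_nonneg: "0 \<le> lp_norm p f"
  by (simp add: lp_norm_def)

lemma lp_norm_powr:
  assumes "0 < p"
  shows "lp_norm p f powr p = (\<Sum>\<^sub>\<infinity>x. \<bar>f x\<bar> powr p)"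
proof -
  have "0 \<le> (\<Sum>\<^sub>\<infinity>x. \<bar>f x\<bar> powr p)"
    by (intro infsum_nonneg) auto
  then show ?thesis
    using assms by (simp add: lp_norm_def powr_powr)
qed

lemma lp_norm_scale:
  assumes "0 < p"
  shows "lp_norm p (\<lambda>x. c * f x) = \<bar>c\<bar> * lp_norm p f"
proof -
  have "(\<Sum>\<^sub>\<infinity>x. \<bar>c * f x\<bar> powr p) = \<bar>c\<bar> powr p * (\<Sum>\<^sub>\<infinity>x. \<bar>f x\<bar> powr p)"
    by (simp add: abs_mult powr_mult infsum_cmult_right')
  moreover have "0 \<le> (\<Sum>\<^sub>\<infinity>x. \<bar>f x\<bar> powr p)"
    by (intro infsum_nonneg) auto
  ultimately show ?thesis
    using assms by (simp add: lp_norm_def powr_mult powr_powr)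
qed

lemma sum_powr_le_lp_norm:
  assumes "0 < p" "(\<lambda>x. \<bar>f x\<bar> powr p) summable_on UNIV" "finite F"
  shows "(\<Sum>x\<in>F. \<bar>f x\<bar> powr p) \<le> lp_norm p f powr p"
  unfolding lp_norm_powr[OF assms(1)]
  by (rule finite_sum_le_infsum) (use assms in auto)

lemma abs_le_lp_norm:
  assumes "0 < p" "(\<lambda>x. \<bar>f x\<bar> powr p) summable_on UNIV"
  shows "\<bar>f x\<bar> \<le> lp_norm p f"
proof -
  have "\<bar>f x\<bar> powr p \<le> lp_norm p f powr p"
    using sum_powr_le_lp_norm[OF assms, of "{x}"] by simp
  then show ?thesis
    by (rule powr_le_powrD[of _ p]) (use assms in \<open>auto simp: lp_norm_nonneg\<close>)
qed

lemma lp_norm_pos: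
  assumes "0 < p" "(\<lambda>x. \<bar>f x\<bar> powr p) summable_on UNIV" "f x \<noteq> 0"
  shows "0 < lp_norm p f"
  using abs_le_lp_norm[OF assms(1,2), of x] assms(3) by linarith

lemma lp_mono_pointwise:
  fixes f :: "int ^ 'd \<Rightarrow> real"
  assumes "0 < p" "p \<le> r" "(\<lambda>x. \<bar>f x\<bar> powr p) summable_on UNIV"
  shows "\<bar>f x\<bar> powr r \<le> lp_norm p f powr (r - p) * \<bar>f x\<bar> powr p"
proof -
  have "\<bar>f x\<bar> powr r = \<bar>f x\<bar> powr (r - p) * \<bar>f x\<bar> powr p"
    by (simp flip: powr_add)
  also have "\<dots> \<le> lp_norm p f powr (r - p) * \<bar>f x\<bar> powr p"
    using abs_le_lp_norm[OF assms(1,3), of x] assms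
    by (intro mult_right_mono powr_mono2) auto
  finally show ?thesis .
qed

text \<open>The inclusion \<open>\<ell>\<^sup>p \<subseteq> \<ell>\<^sup>r\<close> on a discrete space: since no value exceeds the
  \<open>p\<close>-norm, a higher power can only be smaller than the corresponding power of that norm.\<close>
lemma lp_summable_mono:
  fixes f :: "int ^ 'd \<Rightarrow> real"
  assumes "0 < p" "p \<le> r" "(\<lambda>x. \<bar>f x\<bar> powr p) summable_on UNIV"
  shows "(\<lambda>x. \<bar>f x\<bar> powr r) summable_on UNIV"
  by (rule summable_on_real_bound[where g = "\<lambda>x. lp_norm p f powr (r - p) * \<bar>f x\<bar> powr p"])
     (use assms lp_mono_pointwise[OF assms] in \<open>auto intro: summable_on_cmult_right\<close>)

lemma lp_norm_antimono:
  fixes f :: "int ^ 'd \<Rightarrow> real"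
  assumes "0 < p" "p \<le> r" "(\<lambda>x. \<bar>f x\<bar> powr p) summable_on UNIV"
  shows "lp_norm r f \<le> lp_norm p f"
proof -
  have "lp_norm r f powr r = (\<Sum>\<^sub>\<infinity>x. \<bar>f x\<bar> powr r)"
    using assms by (simp add: lp_norm_powr)
  also have "\<dots> \<le> (\<Sum>\<^sub>\<infinity>x. lp_norm p f powr (r - p) * \<bar>f x\<bar> powr p)"
    by (intro infsum_mono lp_summable_mono[OF assms] lp_mono_pointwise[OF assms]
          summable_on_cmult_right assms)
  also have "\<dots> = lp_norm p f powr (r - p) * lp_norm p f powr p"
    using assms by (simp add: infsum_cmult_right' lp_norm_powr)
  also have "\<dots> = lp_norm p f powr r"
    by (simp flip: powr_add)
  finally show ?thesis
    by (rule powr_le_powrD[of _ r]) (use assms in \<open>auto simp: lp_norm_nonneg\<close>)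
qed

text \<open>Hoelder's inequality follows from Young's by normalising both factors.\<close>
lemma Holder_sum:
  fixes f g :: "'a \<Rightarrow> real"
  assumes F: "finite F" and pq: "1 < p" "1 < q" "1 / p + 1 / q = 1"
    and f: "(\<Sum>x\<in>F. \<bar>f x\<bar> powr p) \<le> M powr p" and g: "(\<Sum>x\<in>F. \<bar>g x\<bar> powr q) \<le> N powr q"
    and MN: "0 \<le> M" "0 \<le> N"
  shows "(\<Sum>x\<in>F. \<bar>f x * g x\<bar>) \<le> M * N"
proof -
  have zero: "(\<Sum>x\<in>F. \<bar>f x * g x\<bar>) \<le> M * N" if "M = 0 \<or> N = 0"
  proof -
    have "f x = 0 \<or> g x = 0" if "x \<in> F" for x
    proof -
      have "\<bar>f x\<bar> powr p \<le> M powr p" "\<bar>g x\<bar> powr q \<le> N powr q"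
        using f g member_le_sum[of x F "\<lambda>x. \<bar>f x\<bar> powr p"] member_le_sum[of x F "\<lambda>x. \<bar>g x\<bar> powr q"]
          that F by auto
      then show ?thesis
        using \<open>M = 0 \<or> N = 0\<close> by auto
    qed
    then have "(\<Sum>x\<in>F. \<bar>f x * g x\<bar>) = 0"
      by (intro sum.neutral) auto
    then show ?thesis
      using MN by simp
  qed
  have pos: "(\<Sum>x\<in>F. \<bar>f x * g x\<bar>) \<le> M * N" if "0 < M" "0 < N"
  proof -
    have "\<bar>f x * g x\<bar> / (M * N) \<le> \<bar>f x\<bar> powr p / (M powr p * p) + \<bar>g x\<bar> powr q / (N powr q * q)" for x
      using Youngs_inequality[OF pq, of "\<bar>f x\<bar> / M" "\<bar>g x\<bar> / N"] that
      by (simp add: abs_mult powr_divide)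
    then have "(\<Sum>x\<in>F. \<bar>f x * g x\<bar> / (M * N))
        \<le> (\<Sum>x\<in>F. \<bar>f x\<bar> powr p / (M powr p * p) + \<bar>g x\<bar> powr q / (N powr q * q))"
      by (rule sum_mono)
    also have "\<dots> = (\<Sum>x\<in>F. \<bar>f x\<bar> powr p) / (M powr p * p) + (\<Sum>x\<in>F. \<bar>g x\<bar> powr q) / (N powr q * q)"
      by (simp add: sum.distrib sum_divide_distrib)
    also have "\<dots> \<le> M powr p / (M powr p * p) + N powr q / (N powr q * q)"
      using f g pq by (intro add_mono divide_right_mono) auto
    also have "\<dots> = 1"
      using that pq by simp
    finally show ?thesis
      using that by (simp add: sum_divide_distrib[symmetric] divide_simps)
  qed
  consider "M = 0 \<or> N = 0" | "0 < M" "0 < N"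
    using MN by linarith
  then show ?thesis
    using zero pos by cases auto
qed

text \<open>The extremal function of Hoelder's inequality, restricted to a finite set: it shows that the
  \<open>s\<close>-norm of a function is the supremum of its pairings with finitely supported functions of
  conjugate norm \<open>1\<close>.\<close>
lemma dual_extremiser:
  fixes f :: "int ^ 'd \<Rightarrow> real"
  assumes F: "finite F" and s: "1 < s" and nz: "(\<Sum>x\<in>F. \<bar>f x\<bar> powr s) > 0"
  obtains g where "\<And>x. x \<notin> F \<Longrightarrow> g x = 0" "lp_norm (s / (s - 1)) g = 1"
    "(\<Sum>x\<in>F. f x * g x) = (\<Sum>x\<in>F. \<bar>f x\<bar> powr s) powr (1 / s)"
proof -
  define S where "S = (\<Sum>x\<in>F. \<bar>f x\<bar> powr s)"
  define g where "g x = (if x \<in> F then sgn (f x) * \<bar>f x\<bar> powr (s - 1) / S powr ((s - 1) / s) else 0)" for x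
  have S: "S > 0"
    using nz by (simp add: S_def)
  have pw: "\<bar>g x\<bar> powr (s / (s - 1)) = (if x \<in> F then \<bar>f x\<bar> powr s / S else 0)" for x
    using S s by (auto simp: g_def abs_mult abs_sgn_eq powr_divide powr_powr)
  have "(\<Sum>\<^sub>\<infinity>x. \<bar>g x\<bar> powr (s / (s - 1))) = (\<Sum>\<^sub>\<infinity>x\<in>F. \<bar>f x\<bar> powr s / S)"
    unfolding pw by (rule infsum_cong_neutral) auto
  also have "\<dots> = 1"
    using F S by (simp add: S_def flip: sum_divide_distrib)
  finally have "lp_norm (s / (s - 1)) g = 1"
    by (simp add: lp_norm_def)
  moreover have "(\<Sum>x\<in>F. f x * g x) = S powr (1 / s)"
  proof -
    have "f x * g x = \<bar>f x\<bar> powr s / S powr ((s - 1) / s)" if "x \<in> F" for x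
    proof -
      have "f x * (sgn (f x) * \<bar>f x\<bar> powr (s - 1)) = \<bar>f x\<bar> powr 1 * \<bar>f x\<bar> powr (s - 1)"
        by (simp add: sgn_if)
      also have "\<dots> = \<bar>f x\<bar> powr s"
        unfolding powr_add[symmetric] by simp
      finally show ?thesis
        using that by (simp add: g_def)
    qed
    then have "(\<Sum>x\<in>F. f x * g x) = S / S powr ((s - 1) / s)"
      by (simp add: S_def sum_divide_distrib)
    also have "\<dots> = S powr (1 - (s - 1) / s)"
      using S by (simp add: powr_diff)
    also have "1 - (s - 1) / s = 1 / s"
      using s by (simp add: field_simps)
    finally show ?thesis .
  qed
  ultimately show ?thesis
    by (intro that[of g]) (auto simp: g_def S_def)
qed

section \<open>The Dirichlet form\<close>

definition l2 :: "(int ^ 'd \<Rightarrow> real) \<Rightarrow> bool" where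
  "l2 f \<longleftrightarrow> (\<lambda>x. (f x)\<^sup>2) summable_on UNIV"

text \<open>This is \<open>\<langle>f, P u\<rangle>\<close> for the jump operator \<open>P\<close>. As one sum over pairs, absolutely convergent on
  \<open>\<ell>\<^sup>2\<close>, it turns the self-adjointness of \<open>P\<close> into an exchange of coordinates.\<close>
definition jump_form :: "(int ^ 'd) pmf \<Rightarrow> (int ^ 'd \<Rightarrow> real) \<Rightarrow> (int ^ 'd \<Rightarrow> real) \<Rightarrow> real" where
  "jump_form \<mu> f u = (\<Sum>\<^sub>\<infinity>(x, y). pmf \<mu> (y - x) * (f x * u y))"

text \<open>The energy form \<open>\<langle>f, (I - P) u\<rangle>\<close>.\<close>
definition dirichlet :: "(int ^ 'd) pmf \<Rightarrow> (int ^ 'd \<Rightarrow> real) \<Rightarrow> (int ^ 'd \<Rightarrow> real) \<Rightarrow> real" where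
  "dirichlet \<mu> f u = scalar_prod f u - jump_form \<mu> f u"

lemma abs_mult_le_squares: "\<bar>a * b\<bar> \<le> a\<^sup>2 + (b\<^sup>2 :: real)"
proof -
  have "0 \<le> (\<bar>a\<bar> - \<bar>b\<bar>)\<^sup>2" "0 \<le> \<bar>a * b\<bar>"
    by simp_all
  then show ?thesis
    unfolding power2_diff power2_abs abs_mult by linarith
qed

lemma has_sum_diff_real:
  fixes f g :: "'a \<Rightarrow> real"
  assumes "(f has_sum a) A" "(g has_sum b) A"
  shows "((\<lambda>x. f x - g x) has_sum a - b) A"
  using has_sum_add[OF assms(1), of "\<lambda>x. - g x" "- b"] assms(2) by (simp add: has_sum_uminus)

lemma l2_mult_summable:
  assumes "l2 f" "l2 u"
  shows "(\<lambda>x. f x * u x) summable_on UNIV"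
  by (rule summable_on_real_bound[where g = "\<lambda>x. (f x)\<^sup>2 + (u x)\<^sup>2"])
     (use assms in \<open>auto simp: l2_def abs_mult_le_squares intro: summable_on_add\<close>)

lemma l2_scale: "l2 f \<Longrightarrow> l2 (\<lambda>x. c * f x)"
  by (simp add: l2_def power_mult_distrib summable_on_cmult_right)

lemma l2_add:
  assumes "l2 f" "l2 u"
  shows "l2 (\<lambda>x. f x + u x)"
proof -
  have "(\<lambda>x. (f x)\<^sup>2 + (u x)\<^sup>2 + 2 * (f x * u x)) summable_on UNIV"
    using assms l2_mult_summable[OF assms] unfolding l2_def
    by (intro summable_on_add summable_on_cmult_right)
  then show ?thesis
    by (simp add: l2_def power2_sum mult.assoc)
qed

lemma l2_zero: "l2 (\<lambda>x. 0)"
  by (simp add: l2_def)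

lemma l2_sum:
  assumes "\<And>i. i \<in> I \<Longrightarrow> l2 (u i)"
  shows "l2 (\<lambda>x. \<Sum>i\<in>I. u i x)"
  using assms by (induction I rule: infinite_finite_induct) (auto simp: l2_zero l2_add)

lemma scalar_prod_commute: "scalar_prod f u = scalar_prod u f"
  by (simp add: scalar_prod_def mult.commute)

lemma scalar_prod_scale: "scalar_prod f (\<lambda>x. c * u x) = c * scalar_prod f u"
proof -
  have "f x * (c * u x) = c * (f x * u x)" for x
    by simp
  then show ?thesis
    by (simp only: scalar_prod_def infsum_cmult_right')
qed

lemma scalar_prod_add:
  assumes "l2 f" "l2 u" "l2 v"
  shows "scalar_prod f (\<lambda>x. u x + v x) = scalar_prod f u + scalar_prod f v"
  unfolding scalar_prod_def distrib_left
  by (intro infsum_add l2_mult_summable assms)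

lemma scalar_prod_sum:
  assumes "l2 f" "\<And>i. i \<in> I \<Longrightarrow> l2 (u i)"
  shows "scalar_prod f (\<lambda>x. \<Sum>i\<in>I. u i x) = (\<Sum>i\<in>I. scalar_prod f (u i))"
  using assms(2)
  by (induction I rule: infinite_finite_induct)
     (auto simp: scalar_prod_add assms(1) l2_sum, auto simp: scalar_prod_def)

lemma pmf_summable_on: "(\<lambda>y. pmf p y) summable_on A"
proof (rule nonneg_bdd_above_summable_on)
  show "bdd_above (sum (pmf p) ` {F. F \<subseteq> A \<and> finite F})"
    by (rule bdd_aboveI2[where M = 1]) (auto simp flip: measure_measure_pmf_finite)
qed auto

lemma infsum_pmf: "(\<Sum>\<^sub>\<infinity>y. pmf p y) = 1"
  using infsetsum_pmf_eq_1[of p UNIV] pmf_abs_summable[of p UNIV]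
  by (simp add: infsetsum_infsum)

lemma has_sum_pmf_shift: "((\<lambda>y. pmf p (y - x)) has_sum 1) UNIV" "((\<lambda>y. pmf p (x - y)) has_sum 1) UNIV"
  for p :: "'a::ab_group_add pmf"
proof -
  have "bij (\<lambda>y. y - x)"
    by (rule bij_betw_byWitness[where f' = "\<lambda>y. y + x"]) auto
  moreover have "bij (\<lambda>y. x - y)"
    by (rule bij_betw_byWitness[where f' = "\<lambda>y. x - y"]) auto
  moreover have "(pmf p has_sum 1) UNIV"
    using has_sum_infsum[OF pmf_summable_on, of p UNIV] by (simp add: infsum_pmf)
  ultimately show "((\<lambda>y. pmf p (y - x)) has_sum 1) UNIV" "((\<lambda>y. pmf p (x - y)) has_sum 1) UNIV"
    using has_sum_reindex_bij_betw[of "\<lambda>y. y - x" UNIV UNIV "pmf p" 1]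
      has_sum_reindex_bij_betw[of "\<lambda>y. x - y" UNIV UNIV "pmf p" 1] by auto
qed

text \<open>The kernel \<open>\<mu>(y - x)\<close> sums to one over \<open>y\<close> and also over \<open>x\<close>. The two families here dominate
  the one that defines \<open>\<langle>f, P u\<rangle>\<close>.\<close>
lemma has_sum_jump_square:
  assumes "l2 f"
  shows "((\<lambda>(x, y). pmf \<mu> (y - x) * (f x)\<^sup>2) has_sum (\<Sum>\<^sub>\<infinity>x. (f x)\<^sup>2)) UNIV"
    and "((\<lambda>(x, y). pmf \<mu> (y - x) * (f y)\<^sup>2) has_sum (\<Sum>\<^sub>\<infinity>x. (f x)\<^sup>2)) UNIV"
proof -
  have inner: "((\<lambda>y. h y * (f x)\<^sup>2) has_sum (f x)\<^sup>2) UNIV"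
    if "(h has_sum 1) UNIV" for x and h :: "int ^ 'a \<Rightarrow> real"
    using has_sum_cmult_left[OF that, of "(f x)\<^sup>2"] by simp
  have *: "((\<lambda>(x, y). h x y * (f x)\<^sup>2) has_sum (\<Sum>\<^sub>\<infinity>x. (f x)\<^sup>2)) UNIV"
    if h: "\<And>x. ((h x) has_sum 1) UNIV" "\<And>x y. 0 \<le> h x y" for h :: "int ^ 'a \<Rightarrow> int ^ 'a \<Rightarrow> real"
  proof -
    let ?k = "\<lambda>(x, y). h x y * (f x)\<^sup>2"
    have i: "(\<lambda>y. ?k (x, y)) summable_on UNIV" "(\<Sum>\<^sub>\<infinity>y. ?k (x, y)) = (f x)\<^sup>2" for x
      using inner[OF h(1)] by (auto simp: has_sum_iff)
    have s: "?k summable_on UNIV"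
      by (rule summable_on_Times_nonneg) (use assms h(2) i in \<open>auto simp: l2_def\<close>)
    have "(\<Sum>\<^sub>\<infinity>x. \<Sum>\<^sub>\<infinity>y. ?k (x, y)) = infsum ?k (UNIV \<times> UNIV)"
      by (rule infsum_Sigma_banach) (use s in simp)
    with s show ?thesis
      by (simp only: i has_sum_iff) simp
  qed
  show "((\<lambda>(x, y). pmf \<mu> (y - x) * (f x)\<^sup>2) has_sum (\<Sum>\<^sub>\<infinity>x. (f x)\<^sup>2)) UNIV"
    by (rule *) (auto intro: has_sum_pmf_shift)
  have "((\<lambda>(y, x). pmf \<mu> (y - x) * (f y)\<^sup>2) has_sum (\<Sum>\<^sub>\<infinity>x. (f x)\<^sup>2)) UNIV"
    by (rule *) (auto intro: has_sum_pmf_shift)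
  then show "((\<lambda>(x, y). pmf \<mu> (y - x) * (f y)\<^sup>2) has_sum (\<Sum>\<^sub>\<infinity>x. (f x)\<^sup>2)) UNIV"
    by (rule has_sum_reindex_bij_witness[of UNIV prod.swap prod.swap, THEN iffD1, rotated -1]) auto
qed

lemma jump_summable:
  assumes "l2 f" "l2 u"
  shows "(\<lambda>(x, y). pmf \<mu> (y - x) * (f x * u y)) summable_on UNIV"
proof (rule summable_on_real_bound)
  show "(\<lambda>z. (case z of (x, y) \<Rightarrow> pmf \<mu> (y - x) * (f x)\<^sup>2)
      + (case z of (x, y) \<Rightarrow> pmf \<mu> (y - x) * (u y)\<^sup>2)) summable_on UNIV"
    by (intro summable_on_add has_sum_jump_square[THEN has_sum_imp_summable] assms)
  show "\<bar>case z of (x, y) \<Rightarrow> pmf \<mu> (y - x) * (f x * u y)\<bar> \<le> (case z of (x, y) \<Rightarrow> pmf \<mu> (y - x) * (f x)\<^sup>2)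
      + (case z of (x, y) \<Rightarrow> pmf \<mu> (y - x) * (u y)\<^sup>2)" for z
    by (cases z) (auto simp: abs_mult[of "pmf _ _"] abs_mult_le_squares mult_left_mono simp flip: distrib_left)
qed

lemma jump_form_iterated:
  assumes "l2 f" "l2 u"
  shows "(\<lambda>x. \<Sum>\<^sub>\<infinity>y. pmf \<mu> (y - x) * (f x * u y)) summable_on UNIV"
    and "jump_form \<mu> f u = (\<Sum>\<^sub>\<infinity>x. \<Sum>\<^sub>\<infinity>y. pmf \<mu> (y - x) * (f x * u y))"
  using summable_on_Sigma_banach[of "\<lambda>x y. pmf \<mu> (y - x) * (f x * u y)" UNIV "\<lambda>_. UNIV"]
    infsum_Sigma'_banach[of "\<lambda>x y. pmf \<mu> (y - x) * (f x * u y)" UNIV "\<lambda>_. UNIV"]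
    jump_summable[OF assms, of \<mu>]
  by (auto simp: jump_form_def)

lemma jump_form_scale: "jump_form \<mu> f (\<lambda>x. c * u x) = c * jump_form \<mu> f u"
proof -
  have "(\<lambda>(x, y). pmf \<mu> (y - x) * (f x * (c * u y))) = (\<lambda>z. c * (case z of (x, y) \<Rightarrow> pmf \<mu> (y - x) * (f x * u y)))"
    by auto
  then show ?thesis
    by (simp only: jump_form_def infsum_cmult_right')
qed

lemma jump_form_add:
  assumes "l2 f" "l2 u" "l2 v"
  shows "jump_form \<mu> f (\<lambda>x. u x + v x) = jump_form \<mu> f u + jump_form \<mu> f v"
proof -
  have "(\<lambda>(x, y). pmf \<mu> (y - x) * (f x * (u y + v y)))
      = (\<lambda>z. (case z of (x, y) \<Rightarrow> pmf \<mu> (y - x) * (f x * u y)) + (case z of (x, y) \<Rightarrow> pmf \<mu> (y - x) * (f x * v y)))"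
    by (auto simp: algebra_simps)
  then show ?thesis
    unfolding jump_form_def by (simp only: infsum_add[OF jump_summable jump_summable] assms)
qed

lemma jump_form_commute:
  assumes "\<And>x. pmf \<mu> x = pmf \<mu> (- x)"
  shows "jump_form \<mu> f u = jump_form \<mu> u f"
  unfolding jump_form_def
proof (rule infsum_reindex_bij_witness[of _ prod.swap prod.swap])
  fix z :: "(int ^ 'a) \<times> (int ^ 'a)"
  show "(case prod.swap z of (x, y) \<Rightarrow> pmf \<mu> (y - x) * (u x * f y)) = (case z of (x, y) \<Rightarrow> pmf \<mu> (y - x) * (f x * u y))"
    using assms[of "snd z - fst z"] by (cases z) simp
qed auto

lemma dirichlet_add:
  assumes "l2 f" "l2 u" "l2 v"
  shows "dirichlet \<mu> f (\<lambda>x. u x + v x) = dirichlet \<mu> f u + dirichlet \<mu> f v"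
  by (simp add: dirichlet_def scalar_prod_add jump_form_add assms)

lemma dirichlet_scale: "dirichlet \<mu> f (\<lambda>x. c * u x) = c * dirichlet \<mu> f u"
  by (simp add: dirichlet_def scalar_prod_scale jump_form_scale algebra_simps)

lemma dirichlet_sum:
  assumes "l2 f" "\<And>i. i \<in> I \<Longrightarrow> l2 (u i)"
  shows "dirichlet \<mu> f (\<lambda>x. \<Sum>i\<in>I. u i x) = (\<Sum>i\<in>I. dirichlet \<mu> f (u i))"
  using assms(2)
proof (induction I rule: infinite_finite_induct)
  case (insert i I)
  then show ?case
    by (simp add: dirichlet_add assms(1) l2_sum)
qed (use dirichlet_scale[of \<mu> f 0] in auto)

lemma dirichlet_commute:
  assumes "\<And>x. pmf \<mu> x = pmf \<mu> (- x)"
  shows "dirichlet \<mu> f u = dirichlet \<mu> u f"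
  using jump_form_commute[of \<mu> f u] assms by (simp add: dirichlet_def scalar_prod_commute)

text \<open>The form is an energy. In the expansion of the square both diagonal terms give
  \<open>\<langle>f, f\<rangle>\<close>, because the jump probabilities sum to one in either variable.\<close>
lemma has_sum_dirichlet:
  assumes "l2 f"
  shows "((\<lambda>(x, y). pmf \<mu> (y - x) * (f x - f y)\<^sup>2) has_sum 2 * dirichlet \<mu> f f) UNIV"
proof -
  have "((\<lambda>z. (case z of (x, y) \<Rightarrow> pmf \<mu> (y - x) * (f x)\<^sup>2) + (case z of (x, y) \<Rightarrow> pmf \<mu> (y - x) * (f y)\<^sup>2)
     + (- 2) * (case z of (x, y) \<Rightarrow> pmf \<mu> (y - x) * (f x * f y)))
     has_sum (\<Sum>\<^sub>\<infinity>x. (f x)\<^sup>2) + (\<Sum>\<^sub>\<infinity>x. (f x)\<^sup>2) + (- 2) * jump_form \<mu> f f) UNIV"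
    unfolding jump_form_def
    by (intro has_sum_add has_sum_cmult_right has_sum_jump_square has_sum_infsum jump_summable assms)
  then show ?thesis
    by (rule has_sum_cong[THEN iffD1, rotated, THEN back_subst[of "\<lambda>s. (_ has_sum s) _"]])
       (auto simp: dirichlet_def scalar_prod_def power2_eq_square algebra_simps)
qed

lemma dirichlet_nonneg:
  assumes "l2 f"
  shows "0 \<le> dirichlet \<mu> f f"
  using has_sum_nonneg[OF has_sum_dirichlet[OF assms, of \<mu>]] by auto

text \<open>Both Cauchy-Schwarz inequalities below come from this. For \<open>c = 0\<close> the quadratic is affine, and a
  nonnegative affine function has no slope.\<close>
lemma discriminant_le:
  fixes a b c :: real
  assumes "0 \<le> c" "\<And>t. 0 \<le> a + 2 * t * b + t\<^sup>2 * c"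
  shows "b\<^sup>2 \<le> a * c"
proof (cases "c = 0")
  case True
  have "b = 0"
  proof (rule ccontr)
    assume "b \<noteq> 0"
    then show False
      using assms(2)[of "- (a + 1) / (2 * b)"] True by (simp add: field_simps)
  qed
  with True show ?thesis by simp
next
  case False
  with assms(1) have "c > 0" by simp
  then show ?thesis
    using assms(2)[of "- b / c"] by (simp add: power2_eq_square field_simps)
qed

lemma dirichlet_Cauchy_Schwarz:
  assumes "\<And>x. pmf \<mu> x = pmf \<mu> (- x)" "l2 f" "l2 u"
  shows "(dirichlet \<mu> f u)\<^sup>2 \<le> dirichlet \<mu> f f * dirichlet \<mu> u u"
proof (rule discriminant_le)
  show "0 \<le> dirichlet \<mu> u u"
    using assms by (intro dirichlet_nonneg)
next
  fix t :: real
  let ?w = "\<lambda>x. f x + t * u x"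
  have tu: "l2 (\<lambda>x. t * u x)" and w: "l2 ?w"
    using assms by (auto intro: l2_add l2_scale)
  have "dirichlet \<mu> ?w ?w = dirichlet \<mu> ?w f + t * dirichlet \<mu> ?w u"
    using assms w tu by (simp add: dirichlet_add dirichlet_scale)
  also have "dirichlet \<mu> ?w f = dirichlet \<mu> f f + t * dirichlet \<mu> f u"
    using assms(2,3) tu dirichlet_commute[OF assms(1), where f = ?w and u = f] by (simp add: dirichlet_add dirichlet_scale)
  also have "dirichlet \<mu> ?w u = dirichlet \<mu> f u + t * dirichlet \<mu> u u"
    using assms(2,3) tu dirichlet_commute[OF assms(1), where f = ?w and u = u]
      dirichlet_commute[OF assms(1), where f = u and u = f] by (simp add: dirichlet_add dirichlet_scale)
  finally show "0 \<le> dirichlet \<mu> f f + 2 * t * dirichlet \<mu> f u + t\<^sup>2 * dirichlet \<mu> u u"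
    using dirichlet_nonneg[OF w, of \<mu>] by (simp add: power2_eq_square algebra_simps)
qed

lemma scalar_prod_Cauchy_Schwarz:
  assumes "l2 f" "l2 u"
  shows "(scalar_prod f u)\<^sup>2 \<le> scalar_prod f f * scalar_prod u u"
proof (rule discriminant_le)
  show "0 \<le> scalar_prod u u"
    by (auto simp: scalar_prod_def intro: infsum_nonneg)
next
  fix t :: real
  let ?w = "\<lambda>x. f x + t * u x"
  have tu: "l2 (\<lambda>x. t * u x)" and w: "l2 ?w"
    using assms by (auto intro: l2_add l2_scale)
  have "scalar_prod ?w ?w = scalar_prod ?w f + t * scalar_prod ?w u"
    using assms w tu by (simp add: scalar_prod_add scalar_prod_scale)
  also have "scalar_prod ?w f = scalar_prod f f + t * scalar_prod f u"
    using assms tu scalar_prod_commute[of ?w f] by (simp add: scalar_prod_add scalar_prod_scale)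
  also have "scalar_prod ?w u = scalar_prod f u + t * scalar_prod u u"
    using assms tu scalar_prod_commute[of ?w u] scalar_prod_commute[of u f]
    by (simp add: scalar_prod_add scalar_prod_scale)
  finally show "0 \<le> scalar_prod f f + 2 * t * scalar_prod f u + t\<^sup>2 * scalar_prod u u"
    using infsum_nonneg[of UNIV "\<lambda>x. ?w x * ?w x"]
    unfolding scalar_prod_def[of ?w ?w, symmetric]
    by (simp only: zero_le_square) (simp add: power2_eq_square algebra_simps)
qed

lemma scalar_prod_minus_generator:
  assumes "l2 f"
  shows "scalar_prod f (\<lambda>x. - generator \<mu> f x) = dirichlet \<mu> f f"
proof -
  have gen: "generator \<mu> f x = (\<Sum>\<^sub>\<infinity>y. pmf \<mu> (y - x) * f y) - f x" for x
  proof -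
    have p: "((\<lambda>y. pmf \<mu> (y - x)) has_sum 1) UNIV"
      by (rule has_sum_pmf_shift)
    have s: "(\<lambda>y. pmf \<mu> (y - x) * f y) summable_on UNIV"
    proof (rule summable_on_real_bound)
      show "(\<lambda>y. pmf \<mu> (y - x) + (f y)\<^sup>2) summable_on UNIV"
        using has_sum_imp_summable[OF p] assms unfolding l2_def by (rule summable_on_add)
      have "(pmf \<mu> z)\<^sup>2 \<le> pmf \<mu> z" for z
        by (simp add: power2_eq_square mult_left_le pmf_le_1)
      then show "\<bar>pmf \<mu> (y - x) * f y\<bar> \<le> pmf \<mu> (y - x) + (f y)\<^sup>2" for y
        using abs_mult_le_squares[of "pmf \<mu> (y - x)" "f y"] by (meson add_right_mono order_trans)
    qed
    have "((\<lambda>y. pmf \<mu> (y - x) * f y - pmf \<mu> (y - x) * f x) has_sum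
        (\<Sum>\<^sub>\<infinity>y. pmf \<mu> (y - x) * f y) - 1 * f x) UNIV"
      by (intro has_sum_diff_real has_sum_infsum s has_sum_cmult_left p)
    then show ?thesis
      unfolding generator_def by (simp add: right_diff_distrib infsumI)
  qed
  have "scalar_prod f (\<lambda>x. - generator \<mu> f x)
      = (\<Sum>\<^sub>\<infinity>x. f x * f x - (\<Sum>\<^sub>\<infinity>y. pmf \<mu> (y - x) * (f x * f y)))"
    unfolding scalar_prod_def gen
    by (intro infsum_cong) (simp add: algebra_simps infsum_cmult_right'[symmetric] del: infsum_cmult_right')
  also have "\<dots> = scalar_prod f f - jump_form \<mu> f f"
    unfolding scalar_prod_def jump_form_iterated(2)[OF assms assms]
    by (intro infsumI has_sum_diff_real has_sum_infsum l2_mult_summable assms jump_form_iterated)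
  finally show ?thesis
    by (simp add: dirichlet_def)
qed

section \<open>A Sobolev inequality for the jump form\<close>

text \<open>The choice of the averaging radius: with \<open>n\<close> of the order of
  \<open>(M\<^sup>2 / D)\<^bsup>1/d\<^esup>\<close> both terms of the bound are of the same size. If this radius is
  below the lattice spacing, the trivial bound \<open>a \<le> M\<close> is already good enough.\<close>
lemma optimise_radius:
  fixes a M D C d \<alpha> p :: real
  assumes pos: "0 < \<alpha>" "\<alpha> < d" "0 < D" "0 < M" "0 \<le> C" "0 \<le> a"
    and p: "p = 2 * d / (d - \<alpha>)" and triv: "a \<le> M"
    and bound: "\<And>n::nat. 1 \<le> n \<Longrightarrow> a \<le> sqrt (C * D * real n powr \<alpha>) + real n powr (- d / p) * M"
  shows "a powr p \<le> (1 + sqrt C + 2 powr (d / p)) powr p * D * M powr (p - 2)"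
proof -
  define K where "K = 1 + sqrt C + 2 powr (d / p)"
  have K: "1 \<le> K" and "sqrt C + 2 powr (d / p) \<le> K"
    using pos by (auto simp: K_def)
  have "2 < p"
    using pos by (simp add: p field_simps)
  have d: "0 < d"
    using pos by simp
  have invp: "1 / p = (d - \<alpha>) / (2 * d)"
    by (simp add: p)
  have M2: "(M\<^sup>2) powr e = M powr (2 * e)" for e
    using pos by (simp add: powr_powr flip: powr_numeral)
  \<comment> \<open>Up to constants, \<open>r\<close> is the radius at which the two terms of the bound agree, and \<open>Q\<close> is their
    common value.\<close>
  define r where "r = (M powr 2 / D) powr (1 / d)"
  have r: "0 < r" using pos by (simp add: r_def)
  define Q where "Q = D powr (1 / p) * M powr (1 - 2 / p)"
  have Qp: "Q powr p = D * M powr (p - 2)"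
  proof -
    have "(1 - 2 / p) * p = p - 2"
      using \<open>2 < p\<close> by (simp add: field_simps)
    then show ?thesis
      using \<open>2 < p\<close> pos by (simp add: Q_def powr_mult powr_powr)
  qed
  have "a \<le> K * Q"
  proof (cases "r < 1")
    case True
    have "M powr 2 / D \<le> 1"
    proof (rule ccontr)
      assume "\<not> ?thesis"
      then have "1 \<le> r"
        unfolding r_def using d by (intro ge_one_powr_ge_zero) auto
      with True show False by simp
    qed
    then have MD: "M powr 2 \<le> D"
      using pos by (simp add: field_simps)
    have "M = M powr (2 * (1 / p)) * M powr (1 - 2 / p)"
      using pos unfolding powr_add[symmetric] by simp
    also have "M powr (2 * (1 / p)) = (M powr 2) powr (1 / p)"
      by (simp only: powr_powr)
    also have "\<dots> * M powr (1 - 2 / p) \<le> Q"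
      unfolding Q_def using MD \<open>2 < p\<close> by (intro mult_right_mono powr_mono2) auto
    finally have "M \<le> Q" .
    moreover have "Q \<le> K * Q"
      using K pos by (simp add: Q_def)
    ultimately show ?thesis
      using triv by linarith
  next
    case False
    define n where "n = nat \<lfloor>r\<rfloor>"
    have n: "1 \<le> n" "real n \<le> r" "r \<le> 2 * real n"
    proof -
      have "1 \<le> \<lfloor>r\<rfloor>" "real n = of_int \<lfloor>r\<rfloor>"
        using False by (auto simp: n_def)
      then show "1 \<le> n" "real n \<le> r" "r \<le> 2 * real n"
        by linarith+
    qed
    have e1: "1 - \<alpha> / d = 2 * (1 / p)" "2 * (\<alpha> / d) = 2 * (1 - 2 / p)"
      using d unfolding p by (auto simp: field_simps)
    have "D * r powr \<alpha> = D powr 1 * (M powr 2 / D) powr (\<alpha> / d)"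
      using pos by (simp add: r_def powr_powr)
    also have "\<dots> = D powr (1 - \<alpha> / d) * M powr (2 * (\<alpha> / d))"
      using pos by (simp add: powr_divide M2 powr_diff)
    also have "\<dots> = Q\<^sup>2"
      unfolding e1 Q_def power2_eq_square by (simp add: powr_add[symmetric] mult.assoc mult.left_commute)
    finally have first: "D * r powr \<alpha> = Q\<^sup>2" .
    have "sqrt (C * D * real n powr \<alpha>) \<le> sqrt (C * Q\<^sup>2)"
      unfolding first[symmetric] using n pos
      by (auto intro!: mult_left_mono powr_mono2 simp: mult.assoc)
    also have "\<dots> = sqrt C * Q"
      using pos by (simp add: real_sqrt_mult Q_def)
    finally have A: "sqrt (C * D * real n powr \<alpha>) \<le> sqrt C * Q" .
    have "real n powr (- d / p) \<le> (r / 2) powr (- d / p)"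
      using n r d \<open>2 < p\<close> by (intro powr_mono2') auto
    also have "\<dots> = 2 powr (d / p) * r powr (- d / p)"
      using r by (simp add: powr_divide powr_minus_divide)
    also have "r powr (- d / p) = (M powr 2 / D) powr (- (1 / p))"
      using d by (simp add: r_def powr_powr)
    also have "\<dots> = D powr (1 / p) * M powr (- 2 / p)"
      using pos by (simp add: powr_divide M2 powr_minus_divide)
    finally have "real n powr (- d / p) * M \<le> 2 powr (d / p) * (D powr (1 / p) * (M powr (- 2 / p) * M powr 1))"
      using pos by (simp add: mult_right_mono mult.assoc)
    also have "\<dots> = 2 powr (d / p) * Q"
      unfolding powr_add[symmetric] Q_def by simp
    finally have "a \<le> sqrt C * Q + 2 powr (d / p) * Q"
      using A bound[OF n(1)] by linarith
    also have "\<dots> \<le> K * Q"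
      by (simp add: K_def distrib_right Q_def)
    finally show ?thesis .
  qed
  then have "a powr p \<le> (K * Q) powr p"
    using \<open>0 \<le> a\<close> \<open>2 < p\<close> by (intro powr_mono2) auto
  also have "\<dots> = K powr p * (D * M powr (p - 2))"
    using K Qp by (simp add: powr_mult Q_def)
  finally show ?thesis
    by (simp add: K_def mult.assoc)
qed

definition int_box :: "nat \<Rightarrow> (int ^ 'd) set" where
  "int_box n = {z. \<forall>i. \<bar>z $ i\<bar> \<le> int n}"

lemma int_box_eq_image: "int_box n = vec_lambda ` (PiE (UNIV :: 'd::finite set) (\<lambda>_. {- int n..int n}))"
proof (intro equalityI subsetI)
  fix z :: "int ^ 'd"
  assume "z \<in> int_box n"
  then have "- int n \<le> z $ i \<and> z $ i \<le> int n" for i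
    unfolding int_box_def using abs_le_iff[of "z $ i" "int n"] by auto
  then have "vec_nth z \<in> PiE (UNIV :: 'd set) (\<lambda>_. {- int n..int n})"
    by auto
  then show "z \<in> vec_lambda ` (PiE (UNIV :: 'd set) (\<lambda>_. {- int n..int n}))"
    by (intro image_eqI[of _ _ "vec_nth z"]) auto
qed (auto simp: int_box_def abs_le_iff Pi_iff PiE_iff minus_le_iff)

lemma finite_int_box: "finite (int_box n :: (int ^ 'd::finite) set)"
  unfolding int_box_eq_image by (intro finite_imageI finite_PiE) auto

lemma card_int_box: "card (int_box n :: (int ^ 'd::finite) set) = (2 * n + 1) ^ CARD('d)"
proof -
  have "inj_on vec_lambda (PiE (UNIV :: 'd set) (\<lambda>_. {- int n..int n}))"
    by (simp add: inj_on_def vec_lambda_inject)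
  then show ?thesis
    unfolding int_box_eq_image by (subst card_image) (auto simp: card_PiE nat_add_distrib nat_mult_distrib)
qed

lemma euclid_norm_int_box:
  fixes z :: "int ^ 'd::finite"
  assumes "z \<in> int_box n"
  shows "euclid_norm z \<le> real CARD('d) * real n"
proof -
  have "euclid_norm z \<le> (\<Sum>i\<in>UNIV. \<bar>real_of_int (z $ i)\<bar>)"
    unfolding euclid_norm_def using norm_le_l1_cart[of "\<chi> i. real_of_int (z $ i)"] by simp
  also have "\<dots> \<le> (\<Sum>i\<in>(UNIV :: 'd set). real n)"
  proof (rule sum_mono)
    fix i
    have "\<bar>z $ i\<bar> \<le> int n"
      using assms by (simp add: int_box_def)
    then show "\<bar>real_of_int (z $ i)\<bar> \<le> real n"
      by linarith
  qed
  finally show ?thesis by simp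
qed

lemma euclid_norm_pos: "z \<noteq> 0 \<Longrightarrow> 0 < euclid_norm z"
  by (auto simp: euclid_norm_def vec_eq_iff)

text \<open>Comparing \<open>f x\<close> with its average over the box of radius \<open>n\<close> around \<open>x\<close>. The oscillation
  is controlled by the local energy at \<open>x\<close>, because every jump inside the box has probability of
  order at least \<open>n\<^bsup>-d-\<alpha>\<^esup>\<close>; the average is controlled by Hoelder's inequality.\<close>
lemma local_average_bound:
  fixes f :: "int ^ 'd::finite \<Rightarrow> real" and \<mu> :: "(int ^ 'd) pmf"
  assumes p: "1 < p" and f: "(\<lambda>x. \<bar>f x\<bar> powr p) summable_on UNIV"
    and c: "0 < c" "0 < \<alpha>" and low: "\<And>x. x \<noteq> 0 \<Longrightarrow> c / euclid_norm x powr (real CARD('d) + \<alpha>) \<le> pmf \<mu> x"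
    and D: "((\<lambda>y. pmf \<mu> (y - x) * (f x - f y)\<^sup>2) has_sum D) UNIV" and n: "1 \<le> n"
  shows "\<bar>f x\<bar> \<le> sqrt (real CARD('d) powr (real CARD('d) + \<alpha>) / c * D * real n powr \<alpha>)
      + real n powr (- real CARD('d) / p) * lp_norm p f"
proof -
  define d where "d = real CARD('d)"
  define B where "B = (int_box n :: (int ^ 'd) set)"
  define b where "b = real (card B)"
  have d: "1 \<le> d"
    by (simp add: d_def Suc_le_eq)
  have finB: "finite B"
    by (simp add: B_def finite_int_box)
  have "real n ^ CARD('d) \<le> real (2 * n + 1) ^ CARD('d)"
    by (intro power_mono) auto
  then have nb: "real n powr d \<le> b"
    using n by (simp add: b_def B_def card_int_box d_def powr_realpow)
  have b: "0 < b"
    using n nb by (auto intro: less_le_trans[rotated])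
  define m where "m = c / (d * real n) powr (d + \<alpha>)"
  have m: "0 < m"
    using c d n by (simp add: m_def)
  have "m * (f x - f (x + z))\<^sup>2 \<le> pmf \<mu> z * (f x - f (x + z))\<^sup>2" if "z \<in> B" for z
  proof (cases "z = 0")
    case False
    have "m \<le> c / euclid_norm z powr (d + \<alpha>)"
      unfolding m_def using euclid_norm_int_box[of z n] euclid_norm_pos[OF False] that c d n
      by (intro divide_left_mono powr_mono2 mult_pos_pos) (auto simp: B_def d_def)
    also have "\<dots> \<le> pmf \<mu> z"
      using low[OF False] by (simp add: d_def)
    finally show ?thesis
      by (intro mult_right_mono) auto
  qed simp
  then have "(\<Sum>z\<in>B. m * (f x - f (x + z))\<^sup>2) \<le> (\<Sum>z\<in>B. pmf \<mu> z * (f x - f (x + z))\<^sup>2)"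
    by (intro sum_mono)
  also have "\<dots> = (\<Sum>y\<in>(+) x ` B. pmf \<mu> (y - x) * (f x - f y)\<^sup>2)"
    by (subst sum.reindex) auto
  also have "\<dots> \<le> D"
    using D finB by (intro finite_sum_le_has_sum[OF D]) auto
  finally have osc: "(\<Sum>z\<in>B. (f x - f (x + z))\<^sup>2) \<le> D / m"
    using m by (simp add: sum_distrib_left[symmetric] field_simps)
  have "((\<Sum>z\<in>B. \<bar>f x - f (x + z)\<bar>) / b)\<^sup>2 \<le> ((\<Sum>z\<in>B. (f x - f (x + z))\<^sup>2) * b) / b\<^sup>2"
    unfolding power_divide using sum_squared_le_sum_of_squares[of "\<lambda>z. \<bar>f x - f (x + z)\<bar>" B]
    by (intro divide_right_mono) (auto simp: b_def)
  also have "\<dots> = (\<Sum>z\<in>B. (f x - f (x + z))\<^sup>2) / b"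
    using b by (simp add: power2_eq_square)
  also have "\<dots> \<le> D / m / real n powr d"
    using osc nb n b m by (intro frac_le sum_nonneg) (auto intro: order_trans[OF sum_nonneg osc])
  also have "\<dots> = d powr (d + \<alpha>) / c * D * real n powr \<alpha>"
    using c d n by (simp add: m_def powr_mult powr_add field_simps)
  finally have first: "(\<Sum>z\<in>B. \<bar>f x - f (x + z)\<bar>) / b \<le> sqrt (d powr (d + \<alpha>) / c * D * real n powr \<alpha>)"
    by (rule real_le_rsqrt)
  define p' where "p' = p / (p - 1)"
  have p': "1 < p'" "1 / p + 1 / p' = 1" "1 / p' = 1 - 1 / p"
    using p by (auto simp: p'_def field_simps)
  have "(\<Sum>z\<in>B. \<bar>f (x + z) * 1\<bar>) \<le> lp_norm p f * b powr (1 / p')"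
  proof (rule Holder_sum[OF finB p p'(1,2)])
    have "(\<Sum>z\<in>B. \<bar>f (x + z)\<bar> powr p) = (\<Sum>y\<in>(+) x ` B. \<bar>f y\<bar> powr p)"
      by (subst sum.reindex) auto
    also have "\<dots> \<le> lp_norm p f powr p"
      using p f finB by (intro sum_powr_le_lp_norm) auto
    finally show "(\<Sum>z\<in>B. \<bar>f (x + z)\<bar> powr p) \<le> lp_norm p f powr p" .
    show "(\<Sum>z\<in>B. \<bar>1\<bar> powr p') \<le> (b powr (1 / p')) powr p'"
      using p'(1) b by (simp add: powr_powr b_def)
  qed (auto simp: lp_norm_nonneg)
  then have "(\<Sum>z\<in>B. \<bar>f (x + z)\<bar>) / b \<le> lp_norm p f * b powr (1 / p') / b"
    using b by (simp add: divide_right_mono)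
  also have "\<dots> = lp_norm p f * b powr (- 1 / p)"
    using b by (simp add: p'(3) powr_diff powr_minus_divide)
  also have "\<dots> \<le> lp_norm p f * (real n powr d) powr (- 1 / p)"
    using nb n p by (intro mult_left_mono powr_mono2') (auto simp: lp_norm_nonneg)
  finally have second: "(\<Sum>z\<in>B. \<bar>f (x + z)\<bar>) / b \<le> real n powr (- d / p) * lp_norm p f"
    by (simp add: powr_powr mult.commute)
  have "b * \<bar>f x\<bar> = (\<Sum>z\<in>B. \<bar>f x\<bar>)"
    by (simp add: b_def)
  also have "\<dots> \<le> (\<Sum>z\<in>B. \<bar>f x - f (x + z)\<bar> + \<bar>f (x + z)\<bar>)"
    by (intro sum_mono) linarith
  finally have "\<bar>f x\<bar> \<le> (\<Sum>z\<in>B. \<bar>f x - f (x + z)\<bar>) / b + (\<Sum>z\<in>B. \<bar>f (x + z)\<bar>) / b"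
    using b by (simp add: sum.distrib field_simps)
  with first second show ?thesis
    by (simp add: d_def)
qed

lemma l2_iff_powr: "l2 f \<longleftrightarrow> (\<lambda>x. \<bar>f x\<bar> powr 2) summable_on UNIV"
  by (simp add: l2_def)

text \<open>Summing the pointwise bound \<open>\<bar>f x\<bar>\<^sup>p \<le> K M\<^bsup>p-2\<^esup> D x\<close> over all sites, with \<open>M\<close> the
  \<open>p\<close>-norm of \<open>f\<close> and \<open>D\<close> its local energy, gives \<open>M\<^sup>p \<le> 2 K M\<^bsup>p-2\<^esup> \<E>(f, f)\<close>. Dividing by
  \<open>M\<^bsup>p-2\<^esup>\<close> is legitimate because \<open>\<ell>\<^sup>2 \<subseteq> \<ell>\<^sup>p\<close> makes \<open>M\<close> finite.\<close>
lemma sobolev_inequality: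
  fixes \<mu> :: "(int ^ 'd::finite) pmf"
  assumes \<alpha>: "0 < \<alpha>" "\<alpha> < real CARD('d)" and c: "0 < c"
    and low: "\<And>x. x \<noteq> 0 \<Longrightarrow> c / euclid_norm x powr (real CARD('d) + \<alpha>) \<le> pmf \<mu> x"
  obtains C where "0 < C"
    "\<And>f. l2 f \<Longrightarrow> (lp_norm (2 * real CARD('d) / (real CARD('d) - \<alpha>)) f)\<^sup>2 \<le> C * dirichlet \<mu> f f"
proof -
  define d where "d = real CARD('d)"
  define p where "p = 2 * d / (d - \<alpha>)"
  define C where "C = d powr (d + \<alpha>) / c"
  define K where "K = (1 + sqrt C + 2 powr (d / p)) powr p"
  have d: "\<alpha> < d" "0 < d"
    using \<alpha> by (auto simp: d_def)
  have p: "2 < p"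
    using \<alpha> d by (simp add: p_def field_simps)
  have C: "0 \<le> C"
    using c by (simp add: C_def)
  have K: "0 < K"
    using real_sqrt_ge_zero[OF C] powr_ge_zero[of 2 "d / p"] unfolding K_def powr_gt_zero by linarith
  have "(lp_norm p f)\<^sup>2 \<le> 2 * K * dirichlet \<mu> f f" if f: "l2 f" for f
  proof (cases "lp_norm p f = 0")
    case True
    then show ?thesis
      using K dirichlet_nonneg[OF f, of \<mu>] by simp
  next
    case False
    define M where "M = lp_norm p f"
    have M: "0 < M"
      using False lp_norm_nonneg[of p f] by (simp add: M_def)
    have fp: "(\<lambda>x. \<bar>f x\<bar> powr p) summable_on UNIV"
      using f p by (intro lp_summable_mono[of 2 p]) (auto simp: l2_iff_powr)
    define D where "D x = (\<Sum>\<^sub>\<infinity>y. pmf \<mu> (y - x) * (f x - f y)\<^sup>2)" for x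
    have E: "(\<lambda>(x, y). pmf \<mu> (y - x) * (f x - f y)\<^sup>2) summable_on UNIV \<times> UNIV"
      "infsum (\<lambda>(x, y). pmf \<mu> (y - x) * (f x - f y)\<^sup>2) (UNIV \<times> UNIV) = 2 * dirichlet \<mu> f f"
      using has_sum_dirichlet[OF f, of \<mu>] by (auto simp: has_sum_iff)
    have Dsum: "D summable_on UNIV" "infsum D UNIV = 2 * dirichlet \<mu> f f"
      using summable_on_Sigma_banach[OF E(1)] infsum_Sigma'_banach[OF E(1)] E(2)
      by (simp_all add: D_def[abs_def])
    have Dx: "((\<lambda>y. pmf \<mu> (y - x) * (f x - f y)\<^sup>2) has_sum D x) UNIV" for x
    proof -
      have "(\<lambda>z. case z of (x, y) \<Rightarrow> pmf \<mu> (y - x) * (f x - f y)\<^sup>2) summable_on Pair x ` UNIV"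
        using E(1) by (rule summable_on_subset_banach) auto
      then show ?thesis
        by (subst (asm) summable_on_reindex) (auto simp: inj_on_def o_def D_def)
    qed
    have D0: "0 \<le> D x" for x
      unfolding D_def by (intro infsum_nonneg) auto
    \<comment> \<open>The radius is defined by a division by the local energy, which may vanish; hence the
      perturbation by \<open>e'\<close>.\<close>
    have pt: "\<bar>f x\<bar> powr p \<le> K * M powr (p - 2) * D x" for x
    proof (rule field_le_epsilon)
      fix e :: real
      assume e: "0 < e"
      define e' where "e' = e / (K * M powr (p - 2))"
      have e': "0 < e'"
        using e K M by (simp add: e'_def)
      have "\<bar>f x\<bar> powr p \<le> K * (D x + e') * M powr (p - 2)"
        unfolding K_def
      proof (rule optimise_radius[OF \<alpha>(1) d(1) _ M C _ p_def])
        show "0 < D x + e'"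
          using D0[of x] e' by simp
        show "\<bar>f x\<bar> \<le> M"
          unfolding M_def using p by (intro abs_le_lp_norm fp) auto
        fix n :: nat
        assume n: "1 \<le> n"
        have "\<bar>f x\<bar> \<le> sqrt (C * D x * real n powr \<alpha>) + real n powr (- d / p) * M"
          unfolding C_def M_def d_def
          using local_average_bound[OF _ fp c \<alpha>(1) low Dx n] p by simp
        also have "\<dots> \<le> sqrt (C * (D x + e') * real n powr \<alpha>) + real n powr (- d / p) * M"
          using C e' by (auto intro!: mult_right_mono mult_left_mono)
        finally show "\<bar>f x\<bar> \<le> sqrt (C * (D x + e') * real n powr \<alpha>) + real n powr (- d / p) * M" .
      qed simp
      also have "\<dots> = K * M powr (p - 2) * D x + e"
        using K M by (simp add: e'_def field_simps)
      finally show "\<bar>f x\<bar> powr p \<le> K * M powr (p - 2) * D x + e" .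
    qed
    have "M powr (p - 2) * M\<^sup>2 = M powr p"
      using M by (simp add: powr_diff)
    also have "\<dots> = (\<Sum>\<^sub>\<infinity>x. \<bar>f x\<bar> powr p)"
      unfolding M_def using p by (intro lp_norm_powr) auto
    also have "\<dots> \<le> (\<Sum>\<^sub>\<infinity>x. K * M powr (p - 2) * D x)"
      by (intro infsum_mono fp summable_on_cmult_right Dsum pt)
    also have "\<dots> = M powr (p - 2) * (2 * K * dirichlet \<mu> f f)"
      using Dsum by (simp add: infsum_cmult_right')
    finally show ?thesis
      using M by (simp add: M_def)
  qed
  then show ?thesis
    using K by (intro that[of "2 * K"]) (auto simp: p_def d_def)
qed

section \<open>Convolution powers and truncated potentials\<close>

primrec walk_law :: "'a::ab_group_add pmf \<Rightarrow> nat \<Rightarrow> 'a pmf" where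
  "walk_law \<mu> 0 = return_pmf 0"
| "walk_law \<mu> (Suc n) = bind_pmf \<mu> (\<lambda>s. map_pmf ((+) s) (walk_law \<mu> n))"

lemma pmf_map_plus: "pmf (map_pmf ((+) s) p) x = pmf p (x - s)" for s :: "'a::ab_group_add"
  using pmf_map_inj'[of "(+) s" p "x - s"] by simp

lemma pmf_convolution:
  fixes p q :: "'a::ab_group_add pmf"
  shows "((\<lambda>y. pmf p y * pmf q (x - y)) has_sum pmf (bind_pmf p (\<lambda>s. map_pmf ((+) s) q)) x) UNIV"
proof -
  let ?h = "\<lambda>y. pmf p y * pmf q (x - y)"
  have s: "?h summable_on UNIV"
    by (rule summable_on_real_bound[OF pmf_summable_on[of p]]) (auto simp: mult_left_le pmf_le_1)
  have "pmf (bind_pmf p (\<lambda>s. map_pmf ((+) s) q)) x = (\<integral>y. pmf q (x - y) \<partial>measure_pmf p)"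
    by (simp add: pmf_bind pmf_map_plus)
  also have "\<dots> = (\<integral>y. ?h y \<partial>count_space UNIV)"
    by (subst measure_pmf_eq_density) (simp add: integral_density)
  also have "\<dots> = infsetsum ?h UNIV"
    by (simp add: infsetsum_def)
  also have "\<dots> = infsum ?h UNIV"
    by (rule infsetsum_infsum) (use s summable_on_iff_abs_summable_on_real[of ?h UNIV] in \<open>simp add: abs_summable_equivalent del: real_norm_def\<close>)
  finally show ?thesis
    using s by (simp add: has_sum_iff)
qed

lemma plus_pmf_assoc: "(\<lambda>z. s + (x + z)) = (+) (s + x)" for s :: "'a::ab_group_add"
  by (simp add: fun_eq_iff add.assoc)

text \<open>The recursion splits off the first step; the law may be split after any number of steps.\<close>
lemma walk_law_add: "walk_law \<mu> (m + n) = bind_pmf (walk_law \<mu> m) (\<lambda>s. map_pmf ((+) s) (walk_law \<mu> n))"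
proof (induction m)
  case 0
  then show ?case
    by (simp add: bind_return_pmf map_pmf_id[unfolded id_def] cong: map_pmf_cong)
next
  case (Suc m)
  then show ?case
    by (simp add: bind_assoc_pmf map_bind_pmf bind_map_pmf pmf.map_comp o_def plus_pmf_assoc)
qed

context
  fixes \<mu> :: "'a::ab_group_add pmf"
  assumes sym: "\<And>x. pmf \<mu> x = pmf \<mu> (- x)"
begin

lemma pmf_walk_law_uminus: "pmf (walk_law \<mu> n) (- x) = pmf (walk_law \<mu> n) x"
proof (induction n arbitrary: x)
  case 0
  then show ?case
    by (simp add: indicator_def)
next
  case (Suc n)
  have "pmf \<mu> (- y) * pmf (walk_law \<mu> n) (x - (- y)) = pmf \<mu> y * pmf (walk_law \<mu> n) (- x - y)" for y
    using Suc[of "- x - y"] sym[of y] by (simp add: algebra_simps)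
  then have "((\<lambda>y. pmf \<mu> y * pmf (walk_law \<mu> n) (- x - y)) has_sum s) UNIV \<longleftrightarrow>
      ((\<lambda>y. pmf \<mu> y * pmf (walk_law \<mu> n) (x - y)) has_sum s) UNIV" for s
    by (intro has_sum_reindex_bij_witness[of _ uminus uminus]) auto
  with pmf_convolution[of \<mu> "walk_law \<mu> n" "- x"] pmf_convolution[of \<mu> "walk_law \<mu> n" x]
  show ?case
    by (auto dest: has_sum_unique)
qed

text \<open>After a reflection, which does not change the laws, the pairing of two translates is a
  convolution. This is the identity \<open>\<langle>P\<^sup>m \<delta>\<^sub>y, P\<^sup>n \<delta>\<^sub>z\<rangle> = \<langle>\<delta>\<^sub>y, P\<^bsup>m+n\<^esup> \<delta>\<^sub>z\<rangle>\<close>.\<close>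
lemma walk_law_inner:
  "((\<lambda>x. pmf (walk_law \<mu> m) (x - y) * pmf (walk_law \<mu> n) (x - z)) has_sum pmf (walk_law \<mu> (m + n)) (y - z)) UNIV"
proof -
  have "pmf (walk_law \<mu> n) (z - y - (x - y)) = pmf (walk_law \<mu> n) (x - z)" for x
    using pmf_walk_law_uminus[of n "x - z"] by (simp add: algebra_simps)
  then have "((\<lambda>x. pmf (walk_law \<mu> m) (x - y) * pmf (walk_law \<mu> n) (x - z)) has_sum s) UNIV \<longleftrightarrow>
      ((\<lambda>w. pmf (walk_law \<mu> m) w * pmf (walk_law \<mu> n) (z - y - w)) has_sum s) UNIV" for s
    by (intro has_sum_reindex_bij_witness[of _ "\<lambda>w. w + y" "\<lambda>x. x - y"]) auto
  then show ?thesis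
    using pmf_convolution[of "walk_law \<mu> m" "walk_law \<mu> n" "z - y"] pmf_walk_law_uminus[of "m + n" "y - z"]
    by (simp add: walk_law_add)
qed

lemma walk_law_step:
  "((\<lambda>y. pmf \<mu> (y - x) * pmf (walk_law \<mu> n) (y - z)) has_sum pmf (walk_law \<mu> (Suc n)) (x - z)) UNIV"
proof -
  have "walk_law \<mu> 1 = \<mu>"
    by (simp add: bind_return_pmf' map_pmf_def bind_return_pmf)
  then show ?thesis
    using walk_law_inner[of 1 x n z] by simp
qed

end

text \<open>For a charge \<open>g\<close> carried by the finite set \<open>F\<close>, the next three objects are \<open>P\<^sup>n g\<close>, the partial
  sum \<open>g + P g + \<dots> + P\<^bsup>N-1\<^esup> g\<close> of its Green potential, and \<open>\<langle>g, P\<^sup>n g\<rangle>\<close>. Since \<open>F\<close>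
  is an explicit argument, all of them are finite sums of translated step laws.\<close>
definition smeared :: "(int ^ 'd) pmf \<Rightarrow> (int ^ 'd \<Rightarrow> real) \<Rightarrow> (int ^ 'd) set \<Rightarrow> nat \<Rightarrow> int ^ 'd \<Rightarrow> real" where
  "smeared \<mu> g F n x = (\<Sum>z\<in>F. g z * pmf (walk_law \<mu> n) (x - z))"

definition potential :: "(int ^ 'd) pmf \<Rightarrow> (int ^ 'd \<Rightarrow> real) \<Rightarrow> (int ^ 'd) set \<Rightarrow> nat \<Rightarrow> int ^ 'd \<Rightarrow> real" where
  "potential \<mu> g F N x = (\<Sum>n<N. smeared \<mu> g F n x)"

definition return_form :: "(int ^ 'd) pmf \<Rightarrow> (int ^ 'd \<Rightarrow> real) \<Rightarrow> (int ^ 'd) set \<Rightarrow> nat \<Rightarrow> real" where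
  "return_form \<mu> g F n = (\<Sum>y\<in>F. \<Sum>z\<in>F. g y * g z * pmf (walk_law \<mu> n) (y - z))"

context
  fixes \<mu> :: "(int ^ 'd) pmf"
  assumes sym: "\<And>x. pmf \<mu> x = pmf \<mu> (- x)"
begin

lemma l2_walk_law: "l2 (\<lambda>x. pmf (walk_law \<mu> n) (x - z))"
  using has_sum_imp_summable[OF walk_law_inner[OF sym, of n z n z]] by (simp add: l2_def power2_eq_square)

lemma l2_smeared: "l2 (smeared \<mu> g F n)"
  unfolding smeared_def by (intro l2_sum l2_scale l2_walk_law)

lemma l2_potential: "l2 (potential \<mu> g F N)"
  unfolding potential_def by (intro l2_sum l2_smeared)

lemma jump_form_walk_law:
  assumes "l2 f"
  shows "jump_form \<mu> f (\<lambda>x. pmf (walk_law \<mu> n) (x - z)) = scalar_prod f (\<lambda>x. pmf (walk_law \<mu> (Suc n)) (x - z))"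
proof -
  have "(\<Sum>\<^sub>\<infinity>y. pmf \<mu> (y - x) * (f x * pmf (walk_law \<mu> n) (y - z))) = f x * pmf (walk_law \<mu> (Suc n)) (x - z)" for x
    using has_sum_cmult_right[OF walk_law_step[OF sym, of x n z], of "f x"] by (simp add: infsumI ac_simps)
  then show ?thesis
    unfolding jump_form_iterated(2)[OF assms l2_walk_law] by (simp add: scalar_prod_def)
qed

lemma dirichlet_smeared:
  assumes "l2 f"
  shows "dirichlet \<mu> f (smeared \<mu> g F n) = scalar_prod f (smeared \<mu> g F n) - scalar_prod f (smeared \<mu> g F (Suc n))"
proof -
  have "dirichlet \<mu> f (\<lambda>x. pmf (walk_law \<mu> n) (x - z)) = scalar_prod f (\<lambda>x. pmf (walk_law \<mu> n) (x - z))
      - scalar_prod f (\<lambda>x. pmf (walk_law \<mu> (Suc n)) (x - z))" for z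
    by (simp only: dirichlet_def jump_form_walk_law[OF assms])
  note K = this
  have "dirichlet \<mu> f (smeared \<mu> g F n) = (\<Sum>z\<in>F. g z * dirichlet \<mu> f (\<lambda>x. pmf (walk_law \<mu> n) (x - z)))"
    unfolding smeared_def dirichlet_scale[symmetric] by (intro dirichlet_sum l2_scale l2_walk_law assms)
  moreover have "scalar_prod f (smeared \<mu> g F k) = (\<Sum>z\<in>F. g z * scalar_prod f (\<lambda>x. pmf (walk_law \<mu> k) (x - z)))" for k
    unfolding smeared_def scalar_prod_scale[symmetric] by (intro scalar_prod_sum l2_scale l2_walk_law assms)
  ultimately show ?thesis
    by (simp only: K right_diff_distrib sum_subtractf)
qed

text \<open>The truncated potential solves \<open>(I - P) u = g - P\<^sup>N g\<close>, as the sum telescopes.\<close>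
lemma dirichlet_potential:
  assumes "l2 f"
  shows "dirichlet \<mu> f (potential \<mu> g F N) = scalar_prod f (smeared \<mu> g F 0) - scalar_prod f (smeared \<mu> g F N)"
proof -
  have "dirichlet \<mu> f (potential \<mu> g F N) = (\<Sum>n<N. dirichlet \<mu> f (smeared \<mu> g F n))"
    unfolding potential_def by (intro dirichlet_sum assms l2_smeared)
  also have "\<dots> = scalar_prod f (smeared \<mu> g F 0) - scalar_prod f (smeared \<mu> g F N)"
    unfolding dirichlet_smeared[OF assms] by (rule sum_lessThan_telescope')
  finally show ?thesis .
qed

lemma scalar_prod_smeared: "scalar_prod (smeared \<mu> g F m) (smeared \<mu> g F n) = return_form \<mu> g F (m + n)"
proof -
  have *: "scalar_prod (\<lambda>x. pmf (walk_law \<mu> m) (x - y)) (\<lambda>x. pmf (walk_law \<mu> n) (x - z))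
      = pmf (walk_law \<mu> (m + n)) (y - z)" for y z
    unfolding scalar_prod_def by (intro infsumI walk_law_inner sym)
  have "scalar_prod (smeared \<mu> g F m) (\<lambda>x. pmf (walk_law \<mu> n) (x - z))
      = (\<Sum>y\<in>F. g y * pmf (walk_law \<mu> (m + n)) (y - z))" for z
  proof -
    have "scalar_prod (\<lambda>x. pmf (walk_law \<mu> n) (x - z)) (smeared \<mu> g F m)
        = (\<Sum>y\<in>F. g y * scalar_prod (\<lambda>x. pmf (walk_law \<mu> n) (x - z)) (\<lambda>x. pmf (walk_law \<mu> m) (x - y)))"
      unfolding smeared_def by (simp only: scalar_prod_sum scalar_prod_scale l2_scale l2_walk_law)
    also have "\<dots> = (\<Sum>y\<in>F. g y * pmf (walk_law \<mu> (m + n)) (y - z))"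
      by (subst scalar_prod_commute) (simp only: *)
    finally show ?thesis
      by (simp only: scalar_prod_commute[of "smeared \<mu> g F m"])
  qed
  then have "scalar_prod (smeared \<mu> g F m) (smeared \<mu> g F n)
      = (\<Sum>z\<in>F. \<Sum>y\<in>F. g z * (g y * pmf (walk_law \<mu> (m + n)) (y - z)))"
    unfolding smeared_def[of _ _ _ n]
    by (simp only: scalar_prod_sum l2_walk_law l2_smeared l2_scale scalar_prod_scale sum_distrib_left)
  also have "\<dots> = return_form \<mu> g F (m + n)"
    unfolding return_form_def by (subst sum.swap) (simp add: ac_simps)
  finally show ?thesis .
qed

lemma scalar_prod_smeared_0:
  assumes "finite F"
  shows "scalar_prod f (smeared \<mu> g F 0) = (\<Sum>x\<in>F. f x * g x)"
proof -
  have "smeared \<mu> g F 0 x = (if x \<in> F then g x else 0)" for x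
  proof -
    have "smeared \<mu> g F 0 x = (\<Sum>z\<in>F. if z = x then g z else 0)"
      unfolding smeared_def by (rule sum.cong) (auto simp: indicator_def)
    then show ?thesis
      using assms by simp
  qed
  then have "scalar_prod f (smeared \<mu> g F 0) = (\<Sum>\<^sub>\<infinity>x\<in>F. f x * g x)"
    unfolding scalar_prod_def by (intro infsum_cong_neutral) auto
  then show ?thesis
    using assms by simp
qed

text \<open>The second sum is the part of the Green series between \<open>N\<close> and \<open>2N\<close>: it is nonnegative for
  \<open>g \<ge> 0\<close>, and it vanishes in the limit when the series converges.\<close>
lemma dirichlet_potential_self:
  "dirichlet \<mu> (potential \<mu> g F N) (potential \<mu> g F N)
    = (\<Sum>n<N. return_form \<mu> g F n) - (\<Sum>n<N. return_form \<mu> g F (n + N))"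
proof -
  have "scalar_prod (potential \<mu> g F N) (smeared \<mu> g F k) = (\<Sum>n<N. return_form \<mu> g F (n + k))" for k
    unfolding scalar_prod_commute[of "potential \<mu> g F N"] unfolding potential_def
    by (simp only: scalar_prod_sum l2_smeared scalar_prod_smeared add.commute)
  then show ?thesis
    by (simp add: dirichlet_potential l2_potential)
qed

end

section \<open>The Green function as a sum of convolution powers\<close>

definition jump_measure :: "(int ^ 'd) pmf \<Rightarrow> (real \<times> (int ^ 'd)) measure" where
  "jump_measure \<mu> = density lborel (\<lambda>s. ennreal (exponential_density 1 s)) \<Otimes>\<^sub>M measure_pmf \<mu>"

lemma walk_space_eq: "walk_space \<mu> = (\<Pi>\<^sub>M n\<in>(UNIV :: nat set). jump_measure \<mu>)"
  by (simp add: walk_space_def jump_measure_def)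

lemma prob_space_holding: "prob_space (density lborel (\<lambda>s. ennreal (exponential_density 1 s)))"
  by (rule prob_space_exponential_density) simp

lemma prob_space_jump_measure: "prob_space (jump_measure \<mu>)"
  unfolding jump_measure_def
  by (intro prob_space_pair prob_space_holding prob_space_measure_pmf)

lemma sets_jump_measure [measurable_cong]: "sets (jump_measure \<mu>) = sets (borel \<Otimes>\<^sub>M count_space UNIV)"
  unfolding jump_measure_def by (intro sets_pair_measure_cong) auto

lemma sequence_space_jump_measure: "sequence_space (jump_measure \<mu>)"
  unfolding sequence_space_def
  by (rule product_prob_spaceI) (rule prob_space_jump_measure)

lemma prob_space_walk_space: "prob_space (walk_space \<mu>)"
  unfolding walk_space_eq by (intro prob_space_PiM prob_space_jump_measure)

lemma sets_walk_space [measurable_cong]: "sets (walk_space \<mu>) = sets (PiM UNIV (\<lambda>_. jump_measure \<mu>))"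
  by (simp add: walk_space_eq)

lemma measurable_holding_time [measurable]: "(\<lambda>\<omega>. fst (\<omega> n)) \<in> borel_measurable (walk_space \<mu>)"
  by measurable

lemma measurable_increment [measurable]: "(\<lambda>\<omega>. snd (\<omega> n)) \<in> measurable (walk_space \<mu>) (count_space UNIV)"
  by measurable

lemma measurable_count_space_plus:
  fixes f g :: "'a \<Rightarrow> 'b::{countable, plus}"
  assumes f: "f \<in> measurable M (count_space UNIV)" and g: "g \<in> measurable M (count_space UNIV)"
  shows "(\<lambda>x. f x + g x) \<in> measurable M (count_space UNIV)"
proof (rule measurable_compose_countable[OF _ f])
  show "(\<lambda>x. i + g x) \<in> measurable M (count_space UNIV)" for i
    by (rule measurable_compose[OF g]) simp
qed

lemma measurable_walk_after [measurable]:
  "(\<lambda>\<omega>. x + (\<Sum>k<n. snd (\<omega> k))) \<in> measurable (walk_space \<mu>) (count_space UNIV)"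
proof -
  have "(\<lambda>\<omega>. (\<Sum>k<n. snd (\<omega> k))) \<in> measurable (walk_space \<mu>) (count_space UNIV)"
  proof (induction n)
    case (Suc n)
    then show ?case
      by (simp add: measurable_count_space_plus)
  qed simp
  then show ?thesis
    by (intro measurable_count_space_plus) auto
qed

lemma measurable_indicator_walk_after [measurable]:
  "(\<lambda>\<omega>. indicator {y} (x + (\<Sum>k<n. snd (\<omega> k))) :: ennreal) \<in> borel_measurable (walk_space \<mu>)"
  by (rule measurable_compose[OF measurable_walk_after]) simp

text \<open>The Markov property at the first jump, for the sequence of independent holding times and
  increments: splitting off its first entry does not change the law of the rest.\<close>
lemma nn_integral_walk_space_split:
  assumes [measurable]: "F \<in> borel_measurable (walk_space \<mu>)"
  shows "(\<integral>\<^sup>+\<omega>. F \<omega> \<partial>walk_space \<mu>) = (\<integral>\<^sup>+z. \<integral>\<^sup>+\<omega>. F (case_nat z \<omega>) \<partial>walk_space \<mu> \<partial>jump_measure \<mu>)"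
proof -
  interpret S: sequence_space "jump_measure \<mu>"
    by (rule sequence_space_jump_measure)
  interpret W: prob_space "walk_space \<mu>"
    by (rule prob_space_walk_space)
  have F [measurable]: "F \<in> borel_measurable (PiM UNIV (\<lambda>_. jump_measure \<mu>))"
    using assms by (simp add: walk_space_eq)
  have "(\<integral>\<^sup>+\<omega>. F \<omega> \<partial>walk_space \<mu>) = (\<integral>\<^sup>+\<omega>. F \<omega> \<partial>distr (jump_measure \<mu> \<Otimes>\<^sub>M S.S) S.S (\<lambda>(s, \<omega>). case_nat s \<omega>))"
    unfolding S.PiM_iter by (simp add: walk_space_eq)
  also have "\<dots> = (\<integral>\<^sup>+p. F (case_nat (fst p) (snd p)) \<partial>(jump_measure \<mu> \<Otimes>\<^sub>M S.S))"
    by (subst nn_integral_distr) (auto simp: case_prod_beta)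
  also have "\<dots> = (\<integral>\<^sup>+z. \<integral>\<^sup>+\<omega>. F (case_nat z \<omega>) \<partial>S.S \<partial>jump_measure \<mu>)"
    by (subst S.P.nn_integral_fst[symmetric]) auto
  finally show ?thesis
    by (simp add: walk_space_eq)
qed

lemma nn_integral_jump_measure:
  assumes [measurable]: "h \<in> borel_measurable borel"
  shows "(\<integral>\<^sup>+z. h (fst z) * k (snd z) \<partial>jump_measure \<mu>)
    = (\<integral>\<^sup>+t. ennreal (exponential_density 1 t) * h t \<partial>lborel) * (\<integral>\<^sup>+s. k s \<partial>measure_pmf \<mu>)"
proof -
  have "(\<integral>\<^sup>+z. h (fst z) * k (snd z) \<partial>jump_measure \<mu>)
      = (\<integral>\<^sup>+t. \<integral>\<^sup>+s. h t * k s \<partial>measure_pmf \<mu> \<partial>density lborel (\<lambda>s. ennreal (exponential_density 1 s)))"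
    unfolding jump_measure_def by (subst measure_pmf.nn_integral_fst[symmetric]) auto
  also have "\<dots> = (\<integral>\<^sup>+t. h t \<partial>density lborel (\<lambda>s. ennreal (exponential_density 1 s))) * (\<integral>\<^sup>+s. k s \<partial>measure_pmf \<mu>)"
    by (simp add: nn_integral_cmult nn_integral_multc)
  finally show ?thesis
    by (simp add: nn_integral_density)
qed

lemma exponential_integrals:
  "(\<integral>\<^sup>+t. ennreal (exponential_density 1 t) * ennreal t \<partial>lborel) = 1"
  "(\<integral>\<^sup>+t. ennreal (exponential_density 1 t) * ennreal (exp (- t)) \<partial>lborel) = ennreal (1 / 2)"
  "(\<integral>\<^sup>+t. ennreal (exponential_density 1 t) \<partial>lborel) = 1"
proof -
  have "(\<integral>\<^sup>+t. ennreal (exponential_density 1 t) * ennreal t \<partial>lborel)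
      = (\<integral>\<^sup>+t. ennreal (erlang_density 0 1 t * t ^ 1) \<partial>lborel)"
    by (intro nn_integral_cong) (auto simp: erlang_density_def simp flip: ennreal_mult')
  then show "(\<integral>\<^sup>+t. ennreal (exponential_density 1 t) * ennreal t \<partial>lborel) = 1"
    by (simp only: nn_integral_erlang_ith_moment[of 1 0 1, simplified])
       (use nn_integral_erlang_ith_moment[of 1 0 1] in simp)
  have "(\<integral>\<^sup>+t. ennreal (exponential_density 1 t) * ennreal (exp (- t)) \<partial>lborel)
      = (\<integral>\<^sup>+t. ennreal (1 / 2) * ennreal (erlang_density 0 2 t * t ^ 0) \<partial>lborel)"
  proof (intro nn_integral_cong)
    fix t :: real
    have "exponential_density 1 t * exp (- t) = 1 / 2 * (erlang_density 0 2 t * t ^ 0)"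
      by (auto simp: erlang_density_def exp_add[symmetric])
    then have "ennreal (exponential_density 1 t) * ennreal (exp (- t)) = ennreal (1 / 2 * (erlang_density 0 2 t * t ^ 0))"
      by (metis ennreal_mult'' exp_ge_zero)
    also have "\<dots> = ennreal (1 / 2) * ennreal (erlang_density 0 2 t * t ^ 0)"
      by (rule ennreal_mult') simp
    finally show "ennreal (exponential_density 1 t) * ennreal (exp (- t))
        = ennreal (1 / 2) * ennreal (erlang_density 0 2 t * t ^ 0)" .
  qed
  then show "(\<integral>\<^sup>+t. ennreal (exponential_density 1 t) * ennreal (exp (- t)) \<partial>lborel) = ennreal (1 / 2)"
    by (subst (asm) nn_integral_cmult)
       (use nn_integral_erlang_ith_moment[of 2 0 0] in auto)
  show "(\<integral>\<^sup>+t. ennreal (exponential_density 1 t) \<partial>lborel) = 1"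
    using nn_integral_erlang_ith_moment[of 1 0 0] by simp
qed

text \<open>The expected time spent at \<open>y\<close> during the \<open>n\<close>-th holding period is the probability
  that the walk is at \<open>y\<close> after \<open>n\<close> jumps, the holding time having mean one.\<close>
lemma expected_holding_at:
  fixes \<mu> :: "(int ^ 'd::finite) pmf"
  shows "(\<integral>\<^sup>+\<omega>. ennreal (fst (\<omega> n)) * indicator {y} (x + (\<Sum>k<n. snd (\<omega> k))) \<partial>walk_space \<mu>)
    = ennreal (pmf (walk_law \<mu> n) (y - x))"
proof (induction n arbitrary: x)
  case 0
  have "(\<integral>\<^sup>+\<omega>. ennreal (fst (\<omega> 0)) * indicator {y} (x + (\<Sum>k<0. snd (\<omega> k))) \<partial>walk_space \<mu>)
      = (\<integral>\<^sup>+z. ennreal (fst z) * indicator {y} x \<partial>jump_measure \<mu>)"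
    by (subst nn_integral_walk_space_split)
       (auto simp: prob_space.emeasure_space_1[OF prob_space_walk_space])
  also have "\<dots> = indicator {y} x"
    by (subst nn_integral_jump_measure) (auto simp: exponential_integrals)
  also have "\<dots> = ennreal (pmf (walk_law \<mu> 0) (y - x))"
    by (auto simp: indicator_def)
  finally show ?case .
next
  case (Suc n)
  have "(\<integral>\<^sup>+\<omega>. ennreal (fst (\<omega> (Suc n))) * indicator {y} (x + (\<Sum>k<Suc n. snd (\<omega> k))) \<partial>walk_space \<mu>)
      = (\<integral>\<^sup>+z. \<integral>\<^sup>+\<omega>. ennreal (fst (\<omega> n)) * indicator {y} ((x + snd z) + (\<Sum>k<n. snd (\<omega> k))) \<partial>walk_space \<mu> \<partial>jump_measure \<mu>)"
    by (subst nn_integral_walk_space_split, measurable) (simp add: sum.lessThan_Suc_shift add.assoc del: sum.lessThan_Suc)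
  also have "\<dots> = (\<integral>\<^sup>+z. 1 * ennreal (pmf (walk_law \<mu> n) (y - x - snd z)) \<partial>jump_measure \<mu>)"
    by (simp add: Suc diff_diff_eq)
  also have "\<dots> = (\<integral>\<^sup>+s. ennreal (pmf (walk_law \<mu> n) (y - x - s)) \<partial>measure_pmf \<mu>)"
    by (subst nn_integral_jump_measure[where h = "\<lambda>_. 1"]) (auto simp: exponential_integrals)
  also have "\<dots> = ennreal (pmf (walk_law \<mu> (Suc n)) (y - x))"
    by (simp add: ennreal_pmf_bind pmf_map_plus)
  finally show ?case .
qed

text \<open>A unit exponential holding time \<open>T\<close> has \<open>E[exp (- T)] = 1/2\<close>, and holding times are
  independent.\<close>
lemma expected_exp_jump_time:
  fixes \<mu> :: "(int ^ 'd::finite) pmf"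
  shows "(\<integral>\<^sup>+\<omega>. ennreal (exp (- (\<Sum>k<n. fst (\<omega> k)))) \<partial>walk_space \<mu>) = ennreal ((1 / 2) ^ n)"
proof (induction n)
  case 0
  then show ?case
    by (simp add: prob_space.emeasure_space_1[OF prob_space_walk_space])
next
  case (Suc n)
  have "(\<integral>\<^sup>+\<omega>. ennreal (exp (- (\<Sum>k<Suc n. fst (\<omega> k)))) \<partial>walk_space \<mu>)
      = (\<integral>\<^sup>+z. \<integral>\<^sup>+\<omega>. ennreal (exp (- fst z)) * ennreal (exp (- (\<Sum>k<n. fst (\<omega> k)))) \<partial>walk_space \<mu> \<partial>jump_measure \<mu>)"
    by (subst nn_integral_walk_space_split)
       (simp_all add: sum.lessThan_Suc_shift exp_add[symmetric] ennreal_mult[symmetric] del: sum.lessThan_Suc)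
  also have "\<dots> = (\<integral>\<^sup>+z. ennreal (exp (- fst z)) * ennreal ((1 / 2) ^ n) \<partial>jump_measure \<mu>)"
    by (simp add: nn_integral_cmult Suc)
  also have "\<dots> = ennreal (1 / 2) * ennreal ((1 / 2) ^ n)"
    by (subst nn_integral_jump_measure) (auto simp: exponential_integrals measure_pmf.emeasure_space_1)
  also have "\<dots> = ennreal ((1 / 2) ^ Suc n)"
    by (subst ennreal_mult[symmetric]) auto
  finally show ?case .
qed

text \<open>Almost surely there are only finitely many jumps in bounded time: the
  Laplace transform of the \<open>n\<close>-th jump time, taken at \<open>1\<close>, is \<open>2\<^bsup>-n\<^esup>\<close>, and this forces the jump
  times to be unbounded.\<close>
lemma AE_no_explosion:
  fixes \<mu> :: "(int ^ 'd::finite) pmf"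
  shows "AE \<omega> in walk_space \<mu>. \<forall>t. \<exists>n. t < (\<Sum>k<n. fst (\<omega> k))"
proof -
  let ?h = "\<lambda>\<omega>. INF n. ennreal (exp (- (\<Sum>k<n. fst (\<omega> k))))"
  have "(\<integral>\<^sup>+\<omega>. ?h \<omega> \<partial>walk_space \<mu>) \<le> ennreal ((1 / 2) ^ n)" for n
    unfolding expected_exp_jump_time[where n = n and \<mu> = \<mu>, symmetric]
    by (intro nn_integral_mono INF_lower) auto
  moreover have "(\<lambda>n. ennreal ((1 / 2) ^ n)) \<longlonglongrightarrow> ennreal 0"
    by (intro tendsto_ennrealI LIMSEQ_realpow_zero) auto
  ultimately have "(\<integral>\<^sup>+\<omega>. ?h \<omega> \<partial>walk_space \<mu>) \<le> 0"
    using LIMSEQ_le_const[of "\<lambda>n. ennreal ((1 / 2) ^ n)" "ennreal 0"] by auto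
  then have "AE \<omega> in walk_space \<mu>. ?h \<omega> = 0"
    by (subst nn_integral_0_iff_AE[symmetric]) auto
  then show ?thesis
  proof eventually_elim
    case (elim \<omega>)
    show ?case
    proof
      fix t
      have "?h \<omega> < ennreal (exp (- t))"
        unfolding elim by simp
      then obtain n where "ennreal (exp (- (\<Sum>k<n. fst (\<omega> k)))) < ennreal (exp (- t))"
        by (auto simp: INF_less_iff)
      then show "\<exists>n. t < (\<Sum>k<n. fst (\<omega> k))"
        by (auto simp: ennreal_less_iff)
    qed
  qed
qed

lemma AE_holding_times_nonneg:
  fixes \<mu> :: "(int ^ 'd::finite) pmf"
  shows "AE \<omega> in walk_space \<mu>. \<forall>n. 0 \<le> fst (\<omega> n)"
proof -
  interpret pair_sigma_finite "density lborel (\<lambda>s. ennreal (exponential_density 1 s))" "measure_pmf \<mu>"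
    unfolding pair_sigma_finite_def
    by (auto intro!: prob_space_imp_sigma_finite prob_space_holding prob_space_measure_pmf)
  have "AE z in jump_measure \<mu>. 0 \<le> fst z"
    unfolding jump_measure_def
  proof (rule AE_pair_measure)
    show "AE t in density lborel (\<lambda>s. ennreal (exponential_density 1 s)). AE s in measure_pmf \<mu>. 0 \<le> fst (t, s)"
      by (subst AE_density) (auto simp: erlang_density_def intro!: AE_I2)
  qed measurable
  then show ?thesis
    unfolding walk_space_eq AE_all_countable
    by (intro allI AE_PiM_component prob_space_jump_measure) auto
qed

text \<open>At a fixed time \<open>t \<ge> 0\<close> exactly one holding period is running, and its index is the number
  of jumps made so far.\<close>
lemma occupation_decomposition:
  fixes \<omega> :: "nat \<Rightarrow> real \<times> (int ^ 'd)"
  defines "\<sigma> \<equiv> \<lambda>n. \<Sum>k<n. fst (\<omega> k)"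
  assumes nonneg: "\<And>n. 0 \<le> fst (\<omega> n)" and unbounded: "\<And>t. \<exists>n. t < \<sigma> n"
  shows "indicator {0..} t * indicator {y} (walk x t \<omega>)
    = (\<Sum>n. indicator {\<sigma> n..<\<sigma> (Suc n)} t * indicator {y} (x + (\<Sum>k<n. snd (\<omega> k))) :: ennreal)"
proof -
  have mono: "\<sigma> m \<le> \<sigma> n" if "m \<le> n" for m n
    unfolding \<sigma>_def using that nonneg by (intro sum_mono2) auto
  show ?thesis
  proof (cases "0 \<le> t")
    case False
    have "0 \<le> \<sigma> n" for n
      using mono[of 0 n] by (simp add: \<sigma>_def)
    then have "t \<notin> {\<sigma> n..<\<sigma> (Suc n)}" for n
      using False by (meson atLeastLessThan_iff order_trans)
    with False show ?thesis
      by simp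
  next
    case True
    define N where "N = (LEAST n. t < \<sigma> n)"
    have N: "t < \<sigma> N"
      unfolding N_def by (rule LeastI_ex) (rule unbounded)
    then have "N \<noteq> 0"
      using N True by (cases N) (auto simp: \<sigma>_def)
    then obtain m where m: "N = Suc m"
      by (cases N) auto
    have below: "\<sigma> k \<le> t" if "k \<le> m" for k
      using not_less_Least[of k "\<lambda>n. t < \<sigma> n"] that m unfolding N_def by force
    have above: "t < \<sigma> k" if "m < k" for k
      using N mono[of N k] that m by simp
    have "{n. (\<Sum>k\<le>n. fst (\<omega> k)) \<le> t} = {..<m}"
    proof (intro equalityI subsetI)
      fix n
      assume "n \<in> {n. (\<Sum>k\<le>n. fst (\<omega> k)) \<le> t}"
      then have "\<sigma> (Suc n) \<le> t"
        by (simp add: \<sigma>_def lessThan_Suc_atMost)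
      then show "n \<in> {..<m}"
        using above[of "Suc n"] by (metis lessThan_iff not_less not_less_eq)
    next
      fix n
      assume "n \<in> {..<m}"
      then show "n \<in> {n. (\<Sum>k\<le>n. fst (\<omega> k)) \<le> t}"
        using below[of "Suc n"] by (simp add: \<sigma>_def lessThan_Suc_atMost)
    qed
    then have jc: "jump_count \<omega> t = m"
      by (simp add: jump_count_def)
    have ind: "indicator {\<sigma> n..<\<sigma> (Suc n)} t = (if n = m then 1 else 0 :: ennreal)" for n
    proof (cases n m rule: linorder_cases)
      case less
      then show ?thesis
        using below[of "Suc n"] by simp
    next
      case greater
      then show ?thesis
        using above[of n] by simp
    next
      case equal
      then show ?thesis
        using below[of m] above[of "Suc m"] by simp
    qed
    have "(\<lambda>n. indicator {\<sigma> n..<\<sigma> (Suc n)} t * indicator {y} (x + (\<Sum>k<n. snd (\<omega> k))) :: ennreal)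
        = (\<lambda>n. if n = m then indicator {y} (x + (\<Sum>k<m. snd (\<omega> k))) else 0)"
      by (auto simp: ind)
    then have "(\<Sum>n. indicator {\<sigma> n..<\<sigma> (Suc n)} t * indicator {y} (x + (\<Sum>k<n. snd (\<omega> k))) :: ennreal)
        = indicator {y} (x + (\<Sum>k<m. snd (\<omega> k)))"
      using sums_unique[OF sums_single[of m "\<lambda>_. indicator {y} (x + (\<Sum>k<m. snd (\<omega> k))) :: ennreal"]] by simp
    then show ?thesis
      using True by (simp add: walk_def jc)
  qed
qed

lemma occupation_time:
  fixes \<omega> :: "nat \<Rightarrow> real \<times> (int ^ 'd)"
  assumes nonneg: "\<And>n. 0 \<le> fst (\<omega> n)" and unbounded: "\<And>t. \<exists>n. t < (\<Sum>k<n. fst (\<omega> k))"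
  shows "(\<integral>\<^sup>+t. indicator {0..} t * indicator {y} (walk x t \<omega>) \<partial>lborel)
    = (\<Sum>n. ennreal (fst (\<omega> n)) * indicator {y} (x + (\<Sum>k<n. snd (\<omega> k))))"
proof -
  have "emeasure lborel {\<Sum>k<n. fst (\<omega> k)..<\<Sum>k<Suc n. fst (\<omega> k)} = ennreal (fst (\<omega> n))" for n
    using nonneg[of n] by simp
  then show ?thesis
    unfolding occupation_decomposition[OF assms]
    by (subst nn_integral_suminf) (auto simp: nn_integral_multc simp del: sum.lessThan_Suc)
qed

lemma measurable_walk [measurable]:
  fixes \<mu> :: "(int ^ 'd::finite) pmf"
  shows "(\<lambda>(t, \<omega>). walk x t \<omega>) \<in> measurable (lborel \<Otimes>\<^sub>M walk_space \<mu>) (count_space UNIV)"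
proof -
  have jc: "(\<lambda>z. jump_count (snd z) (fst z)) \<in> measurable (lborel \<Otimes>\<^sub>M walk_space \<mu>) (count_space UNIV)"
    unfolding jump_count_def
  proof (rule measurable_card)
    fix n
    have "(\<lambda>z. \<Sum>k\<le>n. fst (snd z k)) \<in> borel_measurable (lborel \<Otimes>\<^sub>M walk_space \<mu>)"
      by (intro borel_measurable_sum measurable_compose[OF measurable_snd measurable_holding_time])
    moreover have "fst \<in> borel_measurable (lborel \<Otimes>\<^sub>M walk_space \<mu>)"
      using measurable_fst[of lborel "walk_space \<mu>"] by simp
    ultimately show "{z \<in> space (lborel \<Otimes>\<^sub>M walk_space \<mu>). n \<in> {n. (\<Sum>k\<le>n. fst (snd z k)) \<le> fst z}}
        \<in> sets (lborel \<Otimes>\<^sub>M walk_space \<mu>)"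
      unfolding mem_Collect_eq by (rule borel_measurable_le)
  qed
  have "(\<lambda>z. x + (\<Sum>k<jump_count (snd z) (fst z). snd (snd z k))) \<in> measurable (lborel \<Otimes>\<^sub>M walk_space \<mu>) (count_space UNIV)"
  proof (rule measurable_compose_countable[OF _ jc])
    show "(\<lambda>z. x + (\<Sum>k<i. snd (snd z k))) \<in> measurable (lborel \<Otimes>\<^sub>M walk_space \<mu>) (count_space UNIV)" for i
      by (rule measurable_compose[OF measurable_snd measurable_walk_after])
  qed
  then show ?thesis
    by (simp add: walk_def case_prod_beta)
qed

text \<open>Fubini turns the Green function into the expected occupation time, which is then summed
  over the holding periods.\<close>
lemma green_eq_suminf:
  fixes \<mu> :: "(int ^ 'd::finite) pmf"
  shows "green \<mu> x y = enn2real (\<Sum>n. ennreal (pmf (walk_law \<mu> n) (y - x)))"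
proof -
  interpret W: prob_space "walk_space \<mu>"
    by (rule prob_space_walk_space)
  interpret pair_sigma_finite lborel "walk_space \<mu>"
    unfolding pair_sigma_finite_def
    by (auto intro: W.sigma_finite_measure_axioms lborel.sigma_finite_measure_axioms)
  have ind [measurable]: "(\<lambda>(t, \<omega>). indicator {y} (walk x t \<omega>) :: ennreal) \<in> borel_measurable (lborel \<Otimes>\<^sub>M walk_space \<mu>)"
    using measurable_compose[OF measurable_walk[of x \<mu>], of "indicator {y}" borel] by (simp add: case_prod_beta)
  have tr: "ennreal (transition \<mu> t x y) = (\<integral>\<^sup>+\<omega>. indicator {y} (walk x t \<omega>) \<partial>walk_space \<mu>)" for t
  proof -
    have [measurable]: "walk x t \<in> measurable (walk_space \<mu>) (count_space UNIV)"
      using measurable_compose[OF measurable_Pair1'[of t lborel "walk_space \<mu>"] measurable_walk[of x \<mu>]] by simp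
    have "(\<integral>\<^sup>+\<omega>. indicator {y} (walk x t \<omega>) \<partial>walk_space \<mu>)
        = (\<integral>\<^sup>+\<omega>. indicator {\<omega> \<in> space (walk_space \<mu>). walk x t \<omega> = y} \<omega> \<partial>walk_space \<mu>)"
      by (intro nn_integral_cong) (auto simp: indicator_def)
    also have "\<dots> = emeasure (walk_space \<mu>) {\<omega> \<in> space (walk_space \<mu>). walk x t \<omega> = y}"
      by (intro nn_integral_indicator) measurable
    finally show ?thesis
      by (simp add: transition_def W.emeasure_eq_measure)
  qed
  have trm [measurable]: "(\<lambda>t. transition \<mu> t x y) \<in> borel_measurable lborel"
  proof -
    have "(\<lambda>t. enn2real (\<integral>\<^sup>+\<omega>. indicator {y} (walk x t \<omega>) \<partial>walk_space \<mu>)) \<in> borel_measurable lborel"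
      by measurable
    then show ?thesis
      by (simp add: tr[symmetric] transition_def)
  qed
  have "green \<mu> x y = enn2real (\<integral>\<^sup>+t. ennreal (indicator {0..} t *\<^sub>R transition \<mu> t x y) \<partial>lborel)"
    unfolding green_def set_lebesgue_integral_def
    by (intro integral_eq_nn_integral) (auto simp: transition_def)
  also have "(\<integral>\<^sup>+t. ennreal (indicator {0..} t *\<^sub>R transition \<mu> t x y) \<partial>lborel)
      = (\<integral>\<^sup>+t. \<integral>\<^sup>+\<omega>. indicator {0..} t * indicator {y} (walk x t \<omega>) \<partial>walk_space \<mu> \<partial>lborel)"
  proof (intro nn_integral_cong)
    fix t :: real
    show "ennreal (indicator {0..} t *\<^sub>R transition \<mu> t x y)
        = (\<integral>\<^sup>+\<omega>. indicator {0..} t * indicator {y} (walk x t \<omega>) \<partial>walk_space \<mu>)"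
      using tr[of t] by (cases "0 \<le> t") auto
  qed
  also have "\<dots> = (\<integral>\<^sup>+\<omega>. \<integral>\<^sup>+t. indicator {0..} t * indicator {y} (walk x t \<omega>) \<partial>lborel \<partial>walk_space \<mu>)"
    by (rule Fubini'[symmetric]) measurable
  also have "\<dots> = (\<integral>\<^sup>+\<omega>. (\<Sum>n. ennreal (fst (\<omega> n)) * indicator {y} (x + (\<Sum>k<n. snd (\<omega> k)))) \<partial>walk_space \<mu>)"
    using AE_no_explosion[of \<mu>] AE_holding_times_nonneg[of \<mu>]
    by (intro nn_integral_cong_AE) (auto elim!: eventually_elim2 simp: occupation_time)
  also have "\<dots> = (\<Sum>n. ennreal (pmf (walk_law \<mu> n) (y - x)))"
    by (subst nn_integral_suminf) (auto simp: expected_holding_at)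
  finally show ?thesis .
qed

section \<open>Duality between the energy and the Green form\<close>

lemma return_form_nonneg:
  assumes "\<And>z. 0 \<le> g z"
  shows "0 \<le> return_form \<mu> g F n"
  unfolding return_form_def by (intro sum_nonneg mult_nonneg_nonneg assms) auto

text \<open>The potential \<open>u\<close> of a nonnegative charge \<open>g\<close> has energy at most \<open>\<langle>u, g\<rangle>\<close>. A Sobolev
  inequality for \<open>u\<close> and Hoelder's inequality for the pairing then close up to a bound on
  \<open>\<langle>u, g\<rangle>\<close> itself, uniformly in the truncation.\<close>
lemma truncated_green_form_le:
  fixes \<mu> :: "(int ^ 'd) pmf"
  assumes sym: "\<And>x. pmf \<mu> x = pmf \<mu> (- x)" and s: "2 \<le> s"
    and sobolev: "\<And>f. l2 f \<Longrightarrow> (lp_norm s f)\<^sup>2 \<le> C * dirichlet \<mu> f f" and C: "0 \<le> C"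
    and F: "finite F" and g: "\<And>z. 0 \<le> g z" "\<And>z. z \<notin> F \<Longrightarrow> g z = 0"
  shows "(\<Sum>n<N. return_form \<mu> g F n) \<le> C * (lp_norm (s / (s - 1)) g)\<^sup>2"
proof -
  define u where "u = potential \<mu> g F N"
  define A where "A = (\<Sum>n<N. return_form \<mu> g F n)"
  have u: "l2 u"
    unfolding u_def by (rule l2_potential[OF sym])
  have A0: "0 \<le> A"
    unfolding A_def by (intro sum_nonneg return_form_nonneg g)
  have "dirichlet \<mu> u u \<le> A"
    unfolding u_def A_def dirichlet_potential_self[OF sym] using return_form_nonneg[of g \<mu> F] g(1)
    by (simp add: sum_nonneg)
  then have norm_u: "(lp_norm s u)\<^sup>2 \<le> C * A"
    using sobolev[OF u] mult_left_mono[OF _ C] order_trans by blast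
  have "A = scalar_prod (smeared \<mu> g F 0) u"
    unfolding u_def potential_def
    by (subst scalar_prod_sum) (simp_all add: l2_smeared[OF sym] scalar_prod_smeared[OF sym] A_def)
  also have "\<dots> = (\<Sum>x\<in>F. u x * g x)"
    by (subst scalar_prod_commute) (rule scalar_prod_smeared_0[OF sym F])
  also have "\<dots> \<le> (\<Sum>x\<in>F. \<bar>u x * g x\<bar>)"
    by (intro sum_mono) auto
  also have "\<dots> \<le> lp_norm s u * lp_norm (s / (s - 1)) g"
  proof (rule Holder_sum[OF F, of s "s / (s - 1)"])
    show "(\<Sum>x\<in>F. \<bar>u x\<bar> powr s) \<le> lp_norm s u powr s"
      using s F u lp_summable_mono[of 2 s u] by (intro sum_powr_le_lp_norm) (auto simp: l2_iff_powr)
    have "finite {x. \<bar>g x\<bar> powr (s / (s - 1)) \<noteq> 0}"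
      using F g(2) by (auto intro: finite_subset[of _ F])
    then have "(\<lambda>x. \<bar>g x\<bar> powr (s / (s - 1))) summable_on UNIV"
      by (subst summable_on_cong_neutral[of "{x. \<bar>g x\<bar> powr (s / (s - 1)) \<noteq> 0}"]) auto
    then show "(\<Sum>x\<in>F. \<bar>g x\<bar> powr (s / (s - 1))) \<le> lp_norm (s / (s - 1)) g powr (s / (s - 1))"
      using s F by (intro sum_powr_le_lp_norm) auto
  qed (use s in \<open>auto simp: lp_norm_nonneg field_simps\<close>)
  finally have "A\<^sup>2 \<le> (lp_norm s u * lp_norm (s / (s - 1)) g)\<^sup>2"
    using A0 by (intro power_mono) auto
  also have "\<dots> \<le> C * A * (lp_norm (s / (s - 1)) g)\<^sup>2"
    unfolding power_mult_distrib using norm_u by (intro mult_right_mono) auto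
  finally have "A * A \<le> (C * (lp_norm (s / (s - 1)) g)\<^sup>2) * A"
    by (simp add: power2_eq_square ac_simps)
  then show ?thesis
    unfolding A_def[symmetric] using A0 C by (cases "A = 0") (auto simp: mult_le_cancel_right)
qed

text \<open>Transience comes from the previous bound for the charge that is one on \<open>{0, x}\<close>, because the
  return form of this charge contains the probability of going from \<open>0\<close> to \<open>x\<close>.\<close>
lemma walk_law_summable:
  fixes \<mu> :: "(int ^ 'd) pmf"
  assumes sym: "\<And>x. pmf \<mu> x = pmf \<mu> (- x)" and s: "2 \<le> s"
    and sobolev: "\<And>f. l2 f \<Longrightarrow> (lp_norm s f)\<^sup>2 \<le> C * dirichlet \<mu> f f" and C: "0 \<le> C"
  shows "summable (\<lambda>n. pmf (walk_law \<mu> n) x)"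
proof (rule summableI_nonneg_bounded)
  define g :: "int ^ 'd \<Rightarrow> real" where "g = indicator {0, x}"
  fix N
  have "(\<Sum>n<N. pmf (walk_law \<mu> n) x) \<le> (\<Sum>n<N. return_form \<mu> g {0, x} n)"
  proof (rule sum_mono)
    fix n
    have "pmf (walk_law \<mu> n) x = g x * g 0 * pmf (walk_law \<mu> n) (x - 0)"
      by (simp add: g_def)
    also have "\<dots> \<le> (\<Sum>z\<in>{0, x}. g x * g z * pmf (walk_law \<mu> n) (x - z))"
      by (rule member_le_sum) (auto simp: g_def)
    also have "\<dots> \<le> return_form \<mu> g {0, x} n"
      unfolding return_form_def
      by (rule member_le_sum[of x]) (auto simp: g_def intro!: sum_nonneg)
    finally show "pmf (walk_law \<mu> n) x \<le> return_form \<mu> g {0, x} n" .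
  qed
  also have "\<dots> \<le> C * (lp_norm (s / (s - 1)) g)\<^sup>2"
    by (rule truncated_green_form_le[OF sym s sobolev C]) (auto simp: g_def)
  finally show "(\<Sum>n<N. pmf (walk_law \<mu> n) x) \<le> C * (lp_norm (s / (s - 1)) g)\<^sup>2" .
qed auto

lemma green_nonneg: "0 \<le> green \<mu> x y"
  by (simp add: green_eq_suminf)

lemma green_form_eq_sum:
  fixes \<mu> :: "(int ^ 'd::finite) pmf"
  assumes F: "finite F" and g: "\<And>z. z \<notin> F \<Longrightarrow> g z = 0"
  shows "scalar_prod g (green_op \<mu> g) = (\<Sum>y\<in>F. \<Sum>z\<in>F. g y * g z * green \<mu> (y - z) 0)"
proof -
  have op: "green_op \<mu> g x = (\<Sum>z\<in>F. green \<mu> (x - z) 0 * g z)" for x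
  proof -
    have "green_op \<mu> g x = (\<Sum>\<^sub>\<infinity>z\<in>F. green \<mu> (x - z) 0 * g z)"
      unfolding green_op_def by (rule infsum_cong_neutral) (auto simp: g)
    then show ?thesis
      using F by simp
  qed
  have "scalar_prod g (green_op \<mu> g) = (\<Sum>\<^sub>\<infinity>y\<in>F. g y * green_op \<mu> g y)"
    unfolding scalar_prod_def by (rule infsum_cong_neutral) (auto simp: g)
  then show ?thesis
    using F by (simp add: op sum_distrib_left ac_simps)
qed

lemma green_form_sums:
  fixes \<mu> :: "(int ^ 'd::finite) pmf"
  assumes sym: "\<And>x. pmf \<mu> x = pmf \<mu> (- x)" and transient: "\<And>x. summable (\<lambda>n. pmf (walk_law \<mu> n) x)"
    and F: "finite F" and g: "\<And>z. z \<notin> F \<Longrightarrow> g z = 0"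
  shows "return_form \<mu> g F sums scalar_prod g (green_op \<mu> g)"
proof -
  have "(\<lambda>n. pmf (walk_law \<mu> n) x) sums green \<mu> x 0" for x
  proof -
    have "green \<mu> x 0 = (\<Sum>n. pmf (walk_law \<mu> n) x)"
      using transient[of x] suminf_nonneg[OF transient[of x]]
      by (simp add: green_eq_suminf pmf_walk_law_uminus[OF sym] suminf_ennreal2)
    then show ?thesis
      using transient[of x] by (simp add: summable_sums)
  qed
  then have "return_form \<mu> g F sums (\<Sum>y\<in>F. \<Sum>z\<in>F. g y * g z * green \<mu> (y - z) 0)"
    unfolding return_form_def[abs_def] by (intro sums_sum sums_mult)
  then show ?thesis
    using green_form_eq_sum[OF F, of g \<mu>] g by simp
qed

text \<open>Passing to \<open>\<bar>g\<bar>\<close> can only increase the Green form and leaves the norm unchanged; this reduces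
  the bound to nonnegative charges.\<close>
lemma green_form_le:
  fixes \<mu> :: "(int ^ 'd::finite) pmf"
  assumes sym: "\<And>x. pmf \<mu> x = pmf \<mu> (- x)" and s: "2 \<le> s"
    and sobolev: "\<And>f. l2 f \<Longrightarrow> (lp_norm s f)\<^sup>2 \<le> C * dirichlet \<mu> f f" and C: "0 \<le> C"
    and g: "finite {x. g x \<noteq> 0}"
  shows "scalar_prod g (green_op \<mu> g) \<le> C * (lp_norm (s / (s - 1)) g)\<^sup>2"
proof -
  let ?F = "{x. g x \<noteq> 0}"
  let ?a = "\<lambda>x. \<bar>g x\<bar>"
  have sums: "return_form \<mu> ?a ?F sums scalar_prod ?a (green_op \<mu> ?a)"
    by (rule green_form_sums[OF sym walk_law_summable[OF sym s sobolev C] g]) auto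
  have "scalar_prod g (green_op \<mu> g) = (\<Sum>y\<in>?F. \<Sum>z\<in>?F. g y * g z * green \<mu> (y - z) 0)"
    by (rule green_form_eq_sum[OF g]) auto
  also have "\<dots> \<le> (\<Sum>y\<in>?F. \<Sum>z\<in>?F. \<bar>g y\<bar> * \<bar>g z\<bar> * green \<mu> (y - z) 0)"
    by (intro sum_mono mult_right_mono green_nonneg) (simp flip: abs_mult)
  also have "\<dots> = scalar_prod ?a (green_op \<mu> ?a)"
    by (rule green_form_eq_sum[OF g, symmetric]) auto
  also have "\<dots> \<le> C * (lp_norm (s / (s - 1)) ?a)\<^sup>2"
    using sums unfolding sums_def
    by (rule LIMSEQ_le_const2)
       (use truncated_green_form_le[OF sym s sobolev C g, of ?a] in auto)
  finally show ?thesis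
    by (simp add: lp_norm_def)
qed

text \<open>The Cauchy-Schwarz inequality between the energy form and the Green form, obtained from
  the one for the energy of \<open>f\<close> and the truncated potentials of \<open>g\<close>. The boundary
  term \<open>\<langle>f, P\<^sup>N g\<rangle>\<close> vanishes in the limit because the squared norm of \<open>P\<^sup>N g\<close> is the \<open>2N\<close>-th
  term of the convergent Green series.\<close>
lemma pairing_le_energy_green:
  fixes \<mu> :: "(int ^ 'd::finite) pmf"
  assumes sym: "\<And>x. pmf \<mu> x = pmf \<mu> (- x)" and transient: "\<And>x. summable (\<lambda>n. pmf (walk_law \<mu> n) x)"
    and F: "finite F" and g: "\<And>z. z \<notin> F \<Longrightarrow> g z = 0" and f: "l2 f"
  shows "(\<Sum>x\<in>F. f x * g x)\<^sup>2 \<le> dirichlet \<mu> f f * scalar_prod g (green_op \<mu> g)"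
proof -
  define a where "a = return_form \<mu> g F"
  define S where "S N = (\<Sum>n<N. a n)" for N
  define G where "G = scalar_prod g (green_op \<mu> g)"
  have "a sums G"
    unfolding a_def G_def by (rule green_form_sums[OF sym transient F g])
  then have S: "S \<longlonglongrightarrow> G" and a: "a \<longlonglongrightarrow> 0"
    using summable_LIMSEQ_zero[OF sums_summable] by (auto simp: sums_def S_def[abs_def])
  have double: "filterlim (\<lambda>N :: nat. N + N) at_top sequentially"
    by (rule filterlim_subseq) (auto simp: strict_mono_def)
  have "(\<lambda>N. S (N + N) - S N) \<longlonglongrightarrow> G - G"
    by (intro tendsto_diff S filterlim_compose[OF S double])
  moreover have "S (N + N) - S N = (\<Sum>n<N. a (n + N))" for N
  proof -
    have "S (N + N) = S N + (\<Sum>n<N. a (n + N))"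
      unfolding S_def using sum.atLeastLessThan_concat[of 0 N "N + N" a] sum.shift_bounds_nat_ivl[of a 0 N N]
      by (simp add: lessThan_atLeast0)
    then show ?thesis by simp
  qed
  ultimately have tail: "(\<lambda>N. \<Sum>n<N. a (n + N)) \<longlonglongrightarrow> 0"
    by simp
  have f_tail: "(\<lambda>N. scalar_prod f (smeared \<mu> g F N)) \<longlonglongrightarrow> 0"
  proof -
    have "(\<lambda>N. sqrt (scalar_prod f f * a (N + N))) \<longlonglongrightarrow> sqrt (scalar_prod f f * 0)"
      by (intro tendsto_real_sqrt tendsto_mult_left filterlim_compose[OF a double])
    then have lim: "(\<lambda>N. sqrt (scalar_prod f f * a (N + N))) \<longlonglongrightarrow> 0"
      by simp
    have "norm (scalar_prod f (smeared \<mu> g F N)) \<le> sqrt (scalar_prod f f * a (N + N))" for N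
      unfolding real_norm_def a_def
      using scalar_prod_Cauchy_Schwarz[OF f l2_smeared[OF sym, of g F N]]
      by (intro real_le_rsqrt) (simp add: scalar_prod_smeared[OF sym])
    then show ?thesis
      by (intro Lim_null_comparison[OF _ lim] always_eventually allI)
  qed
  have "((\<Sum>x\<in>F. f x * g x) - scalar_prod f (smeared \<mu> g F N))\<^sup>2
      \<le> dirichlet \<mu> f f * (S N - (\<Sum>n<N. a (n + N)))" for N
    using dirichlet_Cauchy_Schwarz[OF sym f l2_potential[OF sym, of g F N]]
    by (simp add: dirichlet_potential[OF sym f] dirichlet_potential_self[OF sym] scalar_prod_smeared_0[OF sym F] S_def a_def)
  moreover have "(\<lambda>N. ((\<Sum>x\<in>F. f x * g x) - scalar_prod f (smeared \<mu> g F N))\<^sup>2) \<longlonglongrightarrow> ((\<Sum>x\<in>F. f x * g x) - 0)\<^sup>2"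
    by (intro tendsto_intros f_tail)
  moreover have "(\<lambda>N. dirichlet \<mu> f f * (S N - (\<Sum>n<N. a (n + N)))) \<longlonglongrightarrow> dirichlet \<mu> f f * (G - 0)"
    by (intro tendsto_intros S tail)
  ultimately have "((\<Sum>x\<in>F. f x * g x) - 0)\<^sup>2 \<le> dirichlet \<mu> f f * (G - 0)"
    by (intro LIMSEQ_le[where x = "((\<Sum>x\<in>F. f x * g x) - 0)\<^sup>2"]) auto
  then show ?thesis
    by (simp add: G_def)
qed

text \<open>Testing the last inequality with the extremal function of Hoelder's inequality on a finite set
  \<open>F\<close> bounds the norm of the restriction of \<open>f\<close> to \<open>F\<close>, uniformly in \<open>F\<close>.\<close>
lemma lp_norm_le_green_bound:
  fixes \<mu> :: "(int ^ 'd::finite) pmf"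
  assumes sym: "\<And>x. pmf \<mu> x = pmf \<mu> (- x)" and transient: "\<And>x. summable (\<lambda>n. pmf (walk_law \<mu> n) x)"
    and s: "2 \<le> s" and f: "l2 f"
    and R: "\<And>g. finite {x. g x \<noteq> 0} \<Longrightarrow> lp_norm (s / (s - 1)) g = 1 \<Longrightarrow> scalar_prod g (green_op \<mu> g) \<le> R"
    and R0: "0 \<le> R"
  shows "(lp_norm s f)\<^sup>2 \<le> R * dirichlet \<mu> f f"
proof -
  have sum_s: "(\<lambda>x. \<bar>f x\<bar> powr s) summable_on UNIV"
    using s f by (intro lp_summable_mono[of 2 s]) (auto simp: l2_iff_powr)
  define b where "b = sqrt (R * dirichlet \<mu> f f)"
  have b: "0 \<le> b" "b\<^sup>2 = R * dirichlet \<mu> f f"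
    using R0 dirichlet_nonneg[OF f, of \<mu>] by (auto simp: b_def)
  have "(\<Sum>x\<in>F. \<bar>f x\<bar> powr s) \<le> b powr s" if F: "finite F" for F
  proof (cases "(\<Sum>x\<in>F. \<bar>f x\<bar> powr s) > 0")
    case True
    obtain g where g: "\<And>x. x \<notin> F \<Longrightarrow> g x = 0" "lp_norm (s / (s - 1)) g = 1"
      "(\<Sum>x\<in>F. f x * g x) = (\<Sum>x\<in>F. \<bar>f x\<bar> powr s) powr (1 / s)"
      using dual_extremiser[OF F _ True] s by auto
    have "finite {x. g x \<noteq> 0}"
      using g(1) F by (auto intro: finite_subset[of _ F])
    then have "scalar_prod g (green_op \<mu> g) \<le> R"
      by (rule R[OF _ g(2)])
    then have "dirichlet \<mu> f f * scalar_prod g (green_op \<mu> g) \<le> dirichlet \<mu> f f * R"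
      by (intro mult_left_mono dirichlet_nonneg f)
    then have "((\<Sum>x\<in>F. \<bar>f x\<bar> powr s) powr (1 / s))\<^sup>2 \<le> dirichlet \<mu> f f * R"
      using pairing_le_energy_green[where g = g, OF sym transient F g(1) f] unfolding g(3) by linarith
    then have "(\<Sum>x\<in>F. \<bar>f x\<bar> powr s) powr (1 / s) \<le> b"
      unfolding b_def mult.commute[of R] by (rule real_le_rsqrt)
    then have "((\<Sum>x\<in>F. \<bar>f x\<bar> powr s) powr (1 / s)) powr s \<le> b powr s"
      using s by (intro powr_mono2) auto
    then show ?thesis
      using s True by (simp add: powr_powr)
  next
    case False
    then show ?thesis
      using powr_ge_zero[of b s] by linarith
  qed
  then have "(\<Sum>\<^sub>\<infinity>x. \<bar>f x\<bar> powr s) \<le> b powr s"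
    by (intro infsum_le_finite_sums sum_s)
  then have "lp_norm s f powr s \<le> b powr s"
    using s by (simp only: lp_norm_powr)
  then have "lp_norm s f \<le> b"
    by (rule powr_le_powrD) (use s b in auto)
  then show ?thesis
    unfolding b(2)[symmetric] by (intro power_mono lp_norm_nonneg)
qed

section \<open>The two variational constants\<close>

lemma lp_norm_indicator_singleton: "lp_norm p (indicator {x}) = 1"
proof -
  have "(\<Sum>\<^sub>\<infinity>y. \<bar>indicator {x} y :: real\<bar> powr p) = (\<Sum>\<^sub>\<infinity>y\<in>{x}. 1)"
    by (rule infsum_cong_neutral) auto
  then show ?thesis
    by (simp add: lp_norm_def)
qed

theorem proposition1:
  fixes \<mu> :: "(int ^ 'd::finite) pmf" and \<alpha> q :: real
  assumes "0 < \<alpha>" "\<alpha> < 2" "q > 1"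
    and "\<And>x. pmf \<mu> x = pmf \<mu> (- x)"
    and "\<exists>c1>0. \<exists>c2>0. \<forall>x. x \<noteq> 0 \<longrightarrow>
           c1 / euclid_norm x powr (real CARD('d) + \<alpha>) \<le> pmf \<mu> x \<and>
           pmf \<mu> x \<le> c2 / euclid_norm x powr (real CARD('d) + \<alpha>)"
    and "q * (real CARD('d) - \<alpha>) \<ge> real CARD('d)"
  shows "0 < kappa \<mu> q \<and> kappa \<mu> q < \<infinity> \<and> kappa \<mu> q = 1 / rho \<mu> q"
proof -
  note sym = assms(4)
  let ?E = "\<lambda>f. dirichlet \<mu> f f"
  let ?V = "\<lambda>g. scalar_prod g (green_op \<mu> g)"
  let ?q' = "2 * q / (2 * q - 1)"
  let ?\<delta> = "indicator {0} :: int ^ 'd \<Rightarrow> real"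
  have "{x. ?\<delta> x \<noteq> 0} = {0}"
    by (auto simp: indicator_def)
  then have \<delta>: "finite {x. ?\<delta> x \<noteq> 0}" "lp_norm s ?\<delta> = 1" for s
    by (simp_all only: lp_norm_indicator_singleton finite.intros)
  have q: "2 \<le> 2 * q" "0 < 2 * q"
    using assms(3) by auto
  obtain c1 where c1: "0 < c1" "\<And>x. x \<noteq> 0 \<Longrightarrow> c1 / euclid_norm x powr (real CARD('d) + \<alpha>) \<le> pmf \<mu> x"
    using assms(5) by blast
  have "0 < q * (real CARD('d) - \<alpha>)"
    using assms(6) by (smt (verit) of_nat_0_less_iff zero_less_card_finite)
  then have d: "\<alpha> < real CARD('d)"
    using assms(3) by (simp add: zero_less_mult_iff)
  define p where "p = 2 * real CARD('d) / (real CARD('d) - \<alpha>)"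
  have p: "2 \<le> p" "p \<le> 2 * q"
    using d assms(1,6) by (auto simp: p_def field_simps)
  obtain C where C: "0 < C" "\<And>f. l2 f \<Longrightarrow> (lp_norm p f)\<^sup>2 \<le> C * ?E f"
    using sobolev_inequality[OF assms(1) d c1] unfolding p_def by blast
  have sobolev: "(lp_norm (2 * q) f)\<^sup>2 \<le> C * ?E f" if "l2 f" for f
  proof -
    have "lp_norm (2 * q) f \<le> lp_norm p f"
      using p that lp_summable_mono[of 2 p f] by (intro lp_norm_antimono) (auto simp: l2_iff_powr)
    then have "(lp_norm (2 * q) f)\<^sup>2 \<le> (lp_norm p f)\<^sup>2"
      by (intro power_mono lp_norm_nonneg)
    then show ?thesis
      using C(2)[OF that] by simp
  qed
  have transient: "summable (\<lambda>n. pmf (walk_law \<mu> n) x)" for x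
    using walk_law_summable[OF sym q(1) sobolev] C(1) by simp

  have unit: "l2 f" "0 < lp_norm (2 * q) f" if "lp_norm 2 f = 1" for f :: "int ^ 'd \<Rightarrow> real"
  proof -
    have s: "(\<lambda>x. \<bar>f x\<bar> powr 2) summable_on UNIV" and i: "(\<Sum>\<^sub>\<infinity>x. \<bar>f x\<bar> powr 2) = 1"
      using lp_norm_has_unit[OF that] by auto
    from s show "l2 f"
      by (simp add: l2_iff_powr)
    obtain x where "f x \<noteq> 0"
      using i by fastforce
    then show "0 < lp_norm (2 * q) f"
      using q s by (intro lp_norm_pos lp_summable_mono[of 2 "2 * q"]) auto
  qed
  have kappa: "kappa \<mu> q = (INF f \<in> {f. lp_norm 2 f = 1}. ereal (?E f / (lp_norm (2 * q) f)\<^sup>2))"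
    unfolding kappa_def by (intro INF_cong) (auto simp: scalar_prod_minus_generator unit)
  have "ereal (1 / C) \<le> kappa \<mu> q"
    unfolding kappa
  proof (rule INF_greatest)
    fix f :: "int ^ 'd \<Rightarrow> real"
    assume "f \<in> {f. lp_norm 2 f = 1}"
    then show "ereal (1 / C) \<le> ereal (?E f / (lp_norm (2 * q) f)\<^sup>2)"
      using sobolev[of f] unit[of f] C(1) by (simp add: field_simps)
  qed
  moreover have "kappa \<mu> q \<le> ereal (?E ?\<delta> / (lp_norm (2 * q) ?\<delta>)\<^sup>2)"
    unfolding kappa by (intro INF_lower) (simp add: \<delta>)
  ultimately obtain k where k: "kappa \<mu> q = ereal k" "0 < k"
    using C(1) by (cases "kappa \<mu> q") (auto simp: less_le_trans[of 0 "1 / C"])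

  \<comment> \<open>By homogeneity the definition of \<open>\<kappa>\<close> is a Sobolev inequality with constant \<open>1 / \<kappa>\<close>.\<close>
  have sharp: "(lp_norm (2 * q) f)\<^sup>2 \<le> 1 / k * ?E f" if f: "l2 f" for f
  proof (cases "lp_norm 2 f = 0")
    case True
    have "lp_norm (2 * q) f \<le> lp_norm 2 f"
      using q f by (intro lp_norm_antimono) (auto simp: l2_iff_powr)
    then show ?thesis
      using True lp_norm_nonneg[of "2 * q" f] k dirichlet_nonneg[OF f, of \<mu>] by simp
  next
    case False
    define c where "c = lp_norm 2 f"
    define h where "h x = 1 / c * f x" for x
    have c: "0 < c"
      using False lp_norm_nonneg[of 2 f] by (simp add: c_def)
    have h: "lp_norm 2 h = 1"
      unfolding h_def using c lp_norm_scale[of 2 "1 / c" f] by (simp add: c_def)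
    have hq: "lp_norm (2 * q) h = lp_norm (2 * q) f / c"
      unfolding h_def using c q lp_norm_scale[of "2 * q" "1 / c" f] by simp
    have "?E h = 1 / c * dirichlet \<mu> h f"
      unfolding h_def by (rule dirichlet_scale)
    also have "dirichlet \<mu> h f = dirichlet \<mu> f h"
      by (rule dirichlet_commute[OF sym])
    also have "\<dots> = 1 / c * ?E f"
      unfolding h_def by (rule dirichlet_scale)
    finally have Eh: "?E h = ?E f / c\<^sup>2"
      by (simp add: power2_eq_square)
    have "ereal k \<le> ereal (?E h / (lp_norm (2 * q) h)\<^sup>2)"
      unfolding k(1)[symmetric] kappa by (rule INF_lower) (simp add: h)
    then have "k * (lp_norm (2 * q) h)\<^sup>2 \<le> ?E h"
      using unit(2)[OF h] by (simp add: field_simps)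
    then have "k * (lp_norm (2 * q) f)\<^sup>2 / c\<^sup>2 \<le> ?E f / c\<^sup>2"
      by (simp add: Eh hq power_divide)
    then have "k * (lp_norm (2 * q) f)\<^sup>2 \<le> ?E f"
      using c by (simp add: divide_le_cancel)
    then show ?thesis
      using k(2) by (simp add: field_simps)
  qed
  have V_le: "?V g \<le> 1 / k" if "finite {x. g x \<noteq> 0}" "lp_norm ?q' g = 1" for g
    using green_form_le[OF sym q(1) sharp _ that(1)] that(2) k(2) by simp

  have rho: "rho \<mu> q = (SUP g \<in> {g. finite {x. g x \<noteq> 0} \<and> lp_norm ?q' g = 1}. ereal (?V g))"
    by (simp add: rho_def)
  have "rho \<mu> q \<le> ereal (1 / k)"
    unfolding rho by (rule SUP_least) (use V_le in auto)
  moreover have "ereal (?V ?\<delta>) \<le> rho \<mu> q"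
    unfolding rho by (rule SUP_upper) (use \<delta> in auto)
  ultimately obtain r where r: "rho \<mu> q = ereal r" "r \<le> 1 / k"
    by (cases "rho \<mu> q") auto
  have V_r: "?V g \<le> r" if "finite {x. g x \<noteq> 0}" "lp_norm ?q' g = 1" for g
  proof -
    have "ereal (?V g) \<le> rho \<mu> q"
      unfolding rho by (rule SUP_upper) (use that in auto)
    then show ?thesis
      by (simp add: r)
  qed
  have "?V ?\<delta> = green \<mu> 0 0"
    using green_form_eq_sum[of "{0}" ?\<delta> \<mu>] by simp
  then have r0: "0 \<le> r"
    using V_r[OF \<delta>] green_nonneg[of \<mu> 0 0] by linarith
  have dual: "(lp_norm (2 * q) f)\<^sup>2 \<le> r * ?E f" if "l2 f" for f
    by (rule lp_norm_le_green_bound[OF sym transient q(1) that V_r r0])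
  have "0 < r"
  proof -
    have "1 \<le> r * ?E ?\<delta>"
      using dual[OF unit(1)[OF \<delta>(2)]] \<delta>(2)[of "2 * q"] by simp
    then show ?thesis
      using r0 by (cases "r = 0") auto
  qed
  have "ereal (1 / r) \<le> kappa \<mu> q"
    unfolding kappa
  proof (rule INF_greatest)
    fix f :: "int ^ 'd \<Rightarrow> real"
    assume "f \<in> {f. lp_norm 2 f = 1}"
    then show "ereal (1 / r) \<le> ereal (?E f / (lp_norm (2 * q) f)\<^sup>2)"
      using dual[of f] unit[of f] \<open>0 < r\<close> by (simp add: field_simps)
  qed
  then have "1 / r \<le> k"
    by (simp add: k)
  moreover have "k \<le> 1 / r"
    using r(2) k(2) \<open>0 < r\<close> by (simp add: field_simps)
  ultimately have "k = 1 / r"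
    by (rule antisym[rotated])
  then show ?thesis
    using k r(1) \<open>0 < r\<close> by (simp add: one_ereal_def)
qed

end
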